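(* Let $\mathcal{H}=(C,F,D,G)$ be a hybrid system on $\mathbb{R}^n$ such that $F$ is outer semicontinuous and locally bounded with nonempty and convex images, and $G(x)\neq\emptyset$ for all $x\in D$. Let $B:\mathbb{R}^n\to\mathbb{R}$ be a scalar locally Lipschitz barrier function candidate defining the set $K=\{x\in C\cup D:B(x)\le0\}$, and assume $K$ is closed. Suppose that $B(\eta)\le0$ for all $\eta\in G(x)$ and all $x\in D\cap K$, that $G(x)\subset C\cup D$ for all $x\in D\cap K$, and that there exists an open neighborhood $U(\partial K)$ of $\partial K$ such that $$\max_{\zeta\in\partial_CB(x)}\langle\zeta,\eta\rangle\le0\quad\forall\eta\in F(x)\cap T_C(x),\ \forall x\in(U(\partial K)\setminus K)\cap C,$$ where $\partial_CB$ is the Clarke generalized gradient of $B$. Then $K$ is forward pre-invariant for $\mathcal{H}$.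
   Context: A hybrid system $\mathcal{H}=(C,F,D,G)$ consists of sets $C,D\subset\mathbb{R}^n$ and set-valued maps $F,G:\mathbb{R}^n\rightrightarrows\mathbb{R}^n$, and represents $\dot x\in F(x)$ for $x\in C$ and $x^+\in G(x)$ for $x\in D$. A hybrid time domain is a set $E\subset\mathbb{R}_{\ge0}\times\mathbb{N}$ such that for each $(T,J)\in E$, $E\cap([0,T]\times\{0,\dots,J\})=\bigcup_{j=0}^J([t_j,t_{j+1}]\times\{j\})$ for some $0=t_0\le t_1\le\dots\le t_{J+1}$. A solution $x$ to $\mathcal{H}$ is a function $x:\operatorname{dom}x\to\mathbb{R}^n$ on a hybrid time domain $\operatorname{dom}x$, with $t\mapsto x(t,j)$ locally absolutely continuous on $I^j:=\{t:(t,j)\in\operatorname{dom}x\}$ for each $j$, such that: $x(0,0)\in\mathrm{cl}(C)\cup D$; for every $j$ for which $I^j$ has nonempty interior, $x(t,j)\in C$ for all $t\in\mathrm{int}(I^j)$ and $\dot x(t,j)\in F(x(t,j))$ for almost all $t\in I^j$; and for all $(t,j)\in\operatorname{dom}x$ with $(t,j+1)\in\operatorname{dom}x$, $x(t,j)\in D$ and $x(t,j+1)\in G(x(t,j))$. It starts from $x_o$ if $x(0,0)=x_o$. It is maximal if there is no solution $y$ with $\operatorname{dom}x$ a proper subset of $\operatorname{dom}y$ and $y=x$ on $\operatorname{dom}x$. A set $K\subset C\cup D$ is forward pre-invariant for $\mathcal{H}$ if for each $x_o\in K$ and each maximal solution $x$ starting from $x_o$, $x(t,j)\in K$ for all $(t,j)\in\operatorname{dom}x$.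 $B$ is a barrier function candidate defining $K$ if $K=\{x\in C\cup D:B(x)\le0\}$. The contingent cone of $S$ at $x$ is $T_S(x)=\{v:\liminf_{h\to0^+}|x+hv|_S/h=0\}$, where $|z|_S=\inf_{y\in S}|z-y|$. $\partial S$ denotes the boundary of $S$. The Clarke generalized gradient of a locally Lipschitz $B$ is $\partial_CB(x)=\mathrm{co}\{\lim_{i\to\infty}\nabla B(x_i):x_i\to x,\ x_i\notin\Omega_B,\ x_i\notin\Omega\}$, where $\Omega_B$ is the set of points where $B$ is not differentiable and $\Omega$ is any set of measure zero. *)

theory Defs
  imports "HOL-Analysis.Analysis"
begin

record 'a hybrid_system =
  flow_set :: "'a set"
  flow_map :: "'a \<Rightarrow> 'a set"
  jump_set :: "'a set"
  jump_map :: "'a \<Rightarrow> 'a set"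

definition hybrid_time_domain :: "(real \<times> nat) set \<Rightarrow> bool" where
  "hybrid_time_domain E \<longleftrightarrow> E \<subseteq> {0..} \<times> UNIV \<and>
     (\<forall>(T, J) \<in> E. \<exists>t :: nat \<Rightarrow> real. t 0 = 0 \<and> (\<forall>j\<le>J. t j \<le> t (Suc j)) \<and>
        E \<inter> ({0..T} \<times> {0..J}) = (\<Union>j\<le>J. {t j..t (Suc j)} \<times> {j}))"

(* The family of non-overlapping subintervals is d, a division of a subset t of {a..b}. *)
definition abs_cont_on_interval :: "real \<Rightarrow> real \<Rightarrow> (real \<Rightarrow> 'a::real_normed_vector) \<Rightarrow> bool" where
  "abs_cont_on_interval a b f \<longleftrightarrow>
     (\<forall>\<epsilon>>0. \<exists>\<delta>>0. \<forall>d t. d division_of t \<and> t \<subseteq> {a..b} \<and> (\<Sum>k\<in>d. Sup k - Inf k) < \<delta> \<longrightarrow>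
        (\<Sum>k\<in>d. norm (f (Sup k) - f (Inf k))) < \<epsilon>)"

definition locally_abs_cont_on :: "real set \<Rightarrow> (real \<Rightarrow> 'a::real_normed_vector) \<Rightarrow> bool" where
  "locally_abs_cont_on I f \<longleftrightarrow> (\<forall>a b. a \<le> b \<and> {a..b} \<subseteq> I \<longrightarrow> abs_cont_on_interval a b f)"

definition flow_interval :: "(real \<times> nat) set \<Rightarrow> nat \<Rightarrow> real set" where
  "flow_interval E j = {t. (t, j) \<in> E}"

(* A hybrid arc is a pair of its domain E and a total function x;
   the values of x outside E are irrelevant. *)
definition hybrid_solution ::
  "'a::euclidean_space hybrid_system \<Rightarrow> (real \<times> nat) set \<Rightarrow> (real \<Rightarrow> nat \<Rightarrow> 'a) \<Rightarrow> bool" where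
  "hybrid_solution H E x \<longleftrightarrow>
     hybrid_time_domain E \<and>
     (\<forall>j. locally_abs_cont_on (flow_interval E j) (\<lambda>t. x t j)) \<and>
     (0, 0) \<in> E \<and> x 0 0 \<in> closure (flow_set H) \<union> jump_set H \<and>
     (\<forall>j. interior (flow_interval E j) \<noteq> {} \<longrightarrow>
        (\<forall>t \<in> interior (flow_interval E j). x t j \<in> flow_set H) \<and>
        (AE t in lebesgue. t \<in> flow_interval E j \<longrightarrow>
           (\<exists>v \<in> flow_map H (x t j).
              ((\<lambda>s. x s j) has_vector_derivative v) (at t within flow_interval E j)))) \<and>
     (\<forall>t j. (t, j) \<in> E \<and> (t, Suc j) \<in> E \<longrightarrow>
        x t j \<in> jump_set H \<and> x t (Suc j) \<in> jump_map H (x t j))"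

definition maximal_hybrid_solution ::
  "'a::euclidean_space hybrid_system \<Rightarrow> (real \<times> nat) set \<Rightarrow> (real \<Rightarrow> nat \<Rightarrow> 'a) \<Rightarrow> bool" where
  "maximal_hybrid_solution H E x \<longleftrightarrow> hybrid_solution H E x \<and>
     \<not> (\<exists>E' y. hybrid_solution H E' y \<and> E \<subset> E' \<and> (\<forall>(t, j) \<in> E. y t j = x t j))"

definition forward_pre_invariant :: "'a::euclidean_space hybrid_system \<Rightarrow> 'a set \<Rightarrow> bool" where
  "forward_pre_invariant H K \<longleftrightarrow> K \<subseteq> flow_set H \<union> jump_set H \<and>
     (\<forall>x\<^sub>o \<in> K. \<forall>E x. maximal_hybrid_solution H E x \<and> x 0 0 = x\<^sub>o \<longrightarrow>
        (\<forall>(t, j) \<in> E. x t j \<in> K))"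

definition barrier_candidate ::
  "'a::euclidean_space hybrid_system \<Rightarrow> ('a \<Rightarrow> real) \<Rightarrow> 'a set \<Rightarrow> bool" where
  "barrier_candidate H B K \<longleftrightarrow> K = {x \<in> flow_set H \<union> jump_set H. B x \<le> 0}"

definition outer_semicontinuous ::
  "('a::topological_space \<Rightarrow> 'b::topological_space set) \<Rightarrow> bool" where
  "outer_semicontinuous F \<longleftrightarrow>
     (\<forall>x y xs ys. xs \<longlonglongrightarrow> x \<and> ys \<longlonglongrightarrow> y \<and> (\<forall>i::nat. ys i \<in> F (xs i)) \<longrightarrow> y \<in> F x)"

definition locally_bounded_map ::
  "('a::topological_space \<Rightarrow> 'b::metric_space set) \<Rightarrow> bool" where
  "locally_bounded_map F \<longleftrightarrow> (\<forall>x. \<exists>U. open U \<and> x \<in> U \<and> bounded (\<Union>y\<in>U. F y))"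

definition locally_lipschitz :: "('a::metric_space \<Rightarrow> 'b::metric_space) \<Rightarrow> bool" where
  "locally_lipschitz f \<longleftrightarrow> (\<forall>x. \<exists>r>0. \<exists>L. L-lipschitz_on (ball x r) f)"

(* The library sets infdist z {} = 0, whereas the infimum over the empty set is infinite;
   the conjunct S \<noteq> {} restores the usual value, an empty cone, for empty S. *)
definition contingent_cone :: "'a::euclidean_space set \<Rightarrow> 'a \<Rightarrow> 'a set" where
  "contingent_cone S x =
     {v. S \<noteq> {} \<and> Liminf (at_right 0) (\<lambda>h. ereal (infdist (x + h *\<^sub>R v) S / h)) = 0}"

(* The null set N to be avoided is a parameter. The condition GDERIV f (X i) :> g i says that
   f is differentiable at X i with gradient g i. *)
definition clarke_gradient ::
  "'a::euclidean_space set \<Rightarrow> ('a \<Rightarrow> real) \<Rightarrow> 'a \<Rightarrow> 'a set" where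
  "clarke_gradient N f x = convex hull
     {l. \<exists>X g. X \<longlonglongrightarrow> x \<and> (\<forall>i::nat. X i \<notin> N \<and> GDERIV f (X i) :> g i) \<and> g \<longlonglongrightarrow> l}"

end

theory Submission
  imports Defs
begin

text \<open>
  A jump cannot leave \<^term>\<open>K\<close>, and since \<^term>\<open>K\<close> is closed, a flow that leaves \<^term>\<open>K\<close> passes, right after
  its last time in \<^term>\<open>K\<close>, through points of \<open>(U - K) \<inter> C\<close>. There almost every velocity lies in the
  contingent cone of \<open>C\<close>, because the curve stays in \<open>C\<close>. So the hypothesis bounds the Clarke
  directional derivative of \<open>B\<close> along the velocity by 0; hence \<open>B\<close> does not increase along the flow
  and stays nonpositive, a contradiction.

  To pass from gradients to increments one needs Rademacher's theorem. It is obtained from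
  Vitali's covering theorem: one-dimensional Lipschitz functions are differentiable almost
  everywhere, a closed set is almost nowhere porous at its own points, and the two facts together
  upgrade partial derivatives to total ones.
\<close>

section \<open>Vitali coverings and porosity\<close>

text \<open>The Clarke gradient records only limits of gradients taken off a null set, while the
  curve may run through points where \<open>B\<close> has no gradient at all. So \<open>B\<close>
  cannot simply be differentiated along the curve. It is compared along segments parallel to the
  velocity: almost all of these meet the exceptional set in a null set of parameters, and continuity
  carries the estimate back to the others. The hypothesis constrains single directions at single
  points. Compactness of the bounded gradients extends it to a neighbourhood at the price of a slack
  \<open>c > 0\<close>; so growth at rate at most \<open>c\<close> is what gets proved, with
  \<open>c\<close> adapted to the assumed violation. The covering balls have to contain the given
  point but need not be centred at it. One covering lemma then handles both the holes beside a point
  and the intervals that start or end at a point.\<close>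

lemma emeasure_lborel_le_Vitali:
  fixes A :: "'a::euclidean_space set"
  assumes A: "A \<in> sets borel" and T: "open T" "A \<subseteq> T" and \<nu>: "sets \<nu> = sets borel"
    and cover: "\<And>x d. x \<in> A \<Longrightarrow> 0 < d \<Longrightarrow> \<exists>z r. 0 < r \<and> r < d \<and> x \<in> cball z r \<and>
                  emeasure lborel (A \<inter> cball z r) \<le> emeasure \<nu> (cball z r)"
  shows "emeasure lborel A \<le> emeasure \<nu> T"
proof -
  let ?K = "{(z, r). 0 < r \<and> cball z r \<subseteq> T \<and> emeasure lborel (A \<inter> cball z r) \<le> emeasure \<nu> (cball z r)}"
  let ?B = "\<lambda>i. cball (fst i) (snd i) :: 'a set"
  obtain C where C: "countable C" "C \<subseteq> ?K"
    and disj: "pairwise (\<lambda>i j. disjnt (?B i) (?B j)) C"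
    and neg: "negligible (A - (\<Union>i\<in>C. ?B i))"
  proof (rule Vitali_covering_theorem_cballs [of ?K snd A fst])
    show "\<And>i. i \<in> ?K \<Longrightarrow> 0 < snd i" by auto
  next
    fix x and d :: real assume x: "x \<in> A" and d: "0 < d"
    obtain e where e: "e > 0" "ball x e \<subseteq> T"
      using T x by (meson openE subsetD)
    \<comment> \<open>The ball contains \<open>x\<close> without being centred there, so its points
      are within \<open>2 * r\<close> of \<open>x\<close>; hence the bound
      \<open>e/2\<close>.\<close>
    obtain z r where zr: "0 < r" "r < min d (e/2)" "x \<in> cball z r"
        "emeasure lborel (A \<inter> cball z r) \<le> emeasure \<nu> (cball z r)"
      using cover[OF x, of "min d (e/2)"] d e by (simp del: mem_cball) blast
    have "cball z r \<subseteq> ball x e"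
    proof
      fix y assume "y \<in> cball z r"
      with zr have "dist x z \<le> r" "dist z y \<le> r" by (auto simp: dist_commute)
      then have "dist x y \<le> 2 * r" using dist_triangle[of x y z] by linarith
      then show "y \<in> ball x e" using zr by auto
    qed
    then show "\<exists>i. i \<in> ?K \<and> x \<in> ?B i \<and> snd i < d"
      using zr e by (intro exI[of _ "(z, r)"]) (simp del: mem_cball)
  qed (rule that)
  have dfam: "disjoint_family_on ?B C"
    using disj by (auto simp: disjoint_family_on_def pairwise_def disjnt_def)
  then have dfamA: "disjoint_family_on (\<lambda>i. A \<inter> ?B i) C"
    unfolding disjoint_family_on_def by blast
  have "emeasure lborel A = emeasure lborel (\<Union>i\<in>C. A \<inter> ?B i)"
  proof (rule emeasure_eq_AE)
    show "AE x in lborel. (x \<in> A) = (x \<in> (\<Union>i\<in>C. A \<inter> ?B i))"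
    proof (rule AE_I')
      have "(\<Union>i\<in>C. ?B i) \<in> sets lborel"
        using C(1) by (intro sets.countable_UN') auto
      then have "A - (\<Union>i\<in>C. ?B i) \<in> sets lborel"
        using A by (intro sets.Diff) auto
      then show "A - (\<Union>i\<in>C. ?B i) \<in> null_sets lborel"
        using neg by (simp add: negligible_iff_null_sets null_sets_completion_iff)
    qed auto
    show "(\<Union>i\<in>C. A \<inter> ?B i) \<in> sets lborel"
      using A C(1) by (auto intro!: sets.countable_UN')
  qed (use A in auto)
  also have "\<dots> = (\<integral>\<^sup>+i. emeasure lborel (A \<inter> ?B i) \<partial>count_space C)"
    using A C(1) dfamA by (intro emeasure_UN_countable) auto
  also have "\<dots> \<le> (\<integral>\<^sup>+i. emeasure \<nu> (?B i) \<partial>count_space C)"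
    using C(2) by (intro nn_integral_mono) auto
  also have "\<dots> = emeasure \<nu> (\<Union>i\<in>C. ?B i)"
    using C(1) dfam \<nu> by (intro emeasure_UN_countable[symmetric]) auto
  also have "\<dots> \<le> emeasure \<nu> T"
  proof (rule emeasure_mono)
    show "(\<Union>i\<in>C. ?B i) \<subseteq> T" using C(2) by fastforce
  qed (use T \<nu> in auto)
  finally show ?thesis .
qed

text \<open>Inside an open set only slightly larger than \<open>A\<close>, the Vitali comparison
  with \<open>c\<close> times Lebesgue measure bounds the measure of \<open>A\<close> by little more
  than \<open>c\<close> times itself. This takes the place of the density theorem.\<close>

lemma null_sets_lborel_if_sparse:
  fixes A :: "'a::euclidean_space set" and c :: real
  assumes A: "A \<in> sets borel" and c: "0 \<le> c" "c < 1"
    and cover: "\<And>x d. x \<in> A \<Longrightarrow> 0 < d \<Longrightarrow> \<exists>z r. 0 < r \<and> r < d \<and> x \<in> cball z r \<and>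
                  emeasure lborel (A \<inter> cball z r) \<le> ennreal c * emeasure lborel (cball z r)"
  shows "A \<in> null_sets lborel"
proof -
  \<comment> \<open>A finite measure is required to conclude \<open>m = 0\<close> from
    \<open>m \<le> c * (m + e)\<close>.\<close>
  have bounded_part: "A \<inter> ball 0 (real n) \<in> null_sets lborel" for n :: nat
  proof -
    let ?A = "A \<inter> ball 0 (real n)"
    have bA: "?A \<in> sets borel" using A by auto
    have fin: "emeasure lborel ?A < \<infinity>"
      by (rule emeasure_bounded_finite) (auto intro: bounded_subset[OF bounded_ball])
    define m where "m = measure lborel ?A"
    have em: "emeasure lborel ?A = ennreal m" "0 \<le> m"
      using fin by (auto simp: m_def emeasure_eq_ennreal_measure)
    have le: "m \<le> c * (m + e)" if "e > 0" for e
    proof -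
      obtain T where T: "open T" "?A \<subseteq> T" and small: "emeasure lebesgue (T - ?A) < ennreal e"
        by (rule sets_lebesgue_outer_open[of ?A, OF _ \<open>e > 0\<close>]) (use bA in simp)
      have "emeasure lborel ?A \<le> emeasure (scale_measure (ennreal c) lborel) T"
      proof (rule emeasure_lborel_le_Vitali[OF bA T])
        fix x and d :: real assume "x \<in> ?A" "0 < d"
        then obtain z r where zr: "0 < r" "r < d" "x \<in> cball z r"
          "emeasure lborel (A \<inter> cball z r) \<le> ennreal c * emeasure lborel (cball z r)"
          using cover by blast
        have "emeasure lborel (?A \<inter> cball z r) \<le> emeasure lborel (A \<inter> cball z r)"
          using A by (intro emeasure_mono) auto
        then show "\<exists>z r. 0 < r \<and> r < d \<and> x \<in> cball z r \<and>
            emeasure lborel (?A \<inter> cball z r) \<le> emeasure (scale_measure (ennreal c) lborel) (cball z r)"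
          using zr by (intro exI[of _ z] exI[of _ r]) (simp del: mem_cball)
      qed simp
      also have "\<dots> = ennreal c * emeasure lborel T" by simp
      also have "emeasure lborel T = emeasure lborel (?A \<union> (T - ?A))"
        using T by (intro arg_cong2[where f = emeasure]) auto
      also have "\<dots> = emeasure lborel ?A + emeasure lborel (T - ?A)"
        using bA T by (intro plus_emeasure[symmetric]) auto
      also have "emeasure lborel (T - ?A) = emeasure lebesgue (T - ?A)"
        using bA T(1) by (simp add: emeasure_completion sets.Diff)
      also have "ennreal c * (emeasure lborel ?A + emeasure lebesgue (T - ?A)) \<le> ennreal c * (ennreal m + ennreal e)"
        using small em by (intro mult_left_mono add_mono) auto
      also have "\<dots> = ennreal (c * (m + e))"
        using em c \<open>e > 0\<close> by (simp add: ennreal_mult)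
      finally show ?thesis
        using em c \<open>e > 0\<close> by (simp add: ennreal_le_iff)
    qed
    have "m = 0"
    proof (rule ccontr)
      assume "m \<noteq> 0"
      then have "m > 0" using em by simp
      \<comment> \<open>With this excess, \<open>c * (m + e)\<close> falls short of \<open>m\<close>
        by \<open>(1 - c)\<^sup>2 * m\<close>.\<close>
      define e where "e = (1 - c) * m"
      have "e > 0" using \<open>m > 0\<close> c by (simp add: e_def)
      have "m \<le> c * (m + e)" by (rule le) fact
      also have "\<dots> = m - (1 - c)\<^sup>2 * m"
        by (simp add: e_def power2_eq_square algebra_simps)
      also have "\<dots> < m" using \<open>m > 0\<close> c by simp
      finally show False by simp
    qed
    then show ?thesis using em bA by auto
  qed
  have "A = (\<Union>n::nat. A \<inter> ball 0 (real n))"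
    using reals_Archimedean2 by (auto simp: dist_norm)
  also have "\<dots> \<in> null_sets lborel"
    using bounded_part by (intro null_sets_UN) auto
  finally show ?thesis .
qed

text \<open>A hole of radius \<open>e * R\<close> around a point \<open>z\<close> at distance
  \<open>R\<close> from \<open>x\<close> takes the fraction \<open>e ^ DIM('a)\<close> out of the
  ball of radius \<open>R\<close> around \<open>z\<close>, which has \<open>x\<close> on its
  boundary. Points with such holes at arbitrarily small scales therefore form a sparse set.\<close>

lemma AE_closed_not_porous:
  fixes A :: "'a::euclidean_space set" and e :: real
  assumes A: "closed A" and e: "0 < e" "e < 1"
  shows "AE x in lborel. x \<in> A \<longrightarrow> (\<exists>d>0. \<forall>z. dist z x < d \<longrightarrow> infdist z A \<le> e * dist z x)"
proof -
  \<comment> \<open>For fixed \<open>z\<close> both conditions are open in \<open>x\<close>, so the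
    union over all \<open>z\<close> is open and the set \<open>P\<close> of bad points is
    Borel.\<close>
  define W where "W k = (\<Union>z. {x. dist z x < inverse (real (Suc k))} \<inter> {x. e * dist z x < infdist z A})" for k
  define P where "P = A \<inter> (\<Inter>k. W k)"
  have "open (W k)" for k
    unfolding W_def by (intro open_UN ballI open_Int open_Collect_less continuous_intros)
  then have P: "P \<in> sets borel"
    unfolding P_def using A by (intro sets.Int borel_closed sets.countable_INT') auto
  let ?n = "DIM('a)"
  have "P \<in> null_sets lborel"
  proof (rule null_sets_lborel_if_sparse[OF P])
    show "0 \<le> 1 - e ^ ?n" "1 - e ^ ?n < 1"
      using e by (auto simp: power_le_one)
  next
    fix x and d :: real assume x: "x \<in> P" and d: "0 < d"
    obtain k where k: "inverse (real (Suc k)) < d" using reals_Archimedean[OF d] by auto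
    obtain z where z: "dist z x < inverse (real (Suc k))" "e * dist z x < infdist z A"
      using x unfolding P_def W_def by blast
    define R where "R = dist z x"
    have "x \<in> A" using x by (simp add: P_def)
    have "R \<noteq> 0"
    proof
      assume "R = 0"
      then have "z = x" by (simp add: R_def)
      then show False using z(2) \<open>x \<in> A\<close> by simp
    qed
    then have R: "R > 0" by (simp add: R_def)
    have disj: "ball z (e * R) \<inter> A = {}"
    proof -
      have "e * R < dist z y" if "y \<in> A" for y
        using z(2) infdist_le[OF that, of z] by (simp add: R_def)
      then show ?thesis by fastforce
    qed
    have eR: "e * R \<le> R" using e R by simp
    then have sub: "ball z (e * R) \<subseteq> cball z R"
      by (meson ball_subset_cball order_trans subset_ball)
    have "emeasure lborel (P \<inter> cball z R) \<le> emeasure lborel (cball z R - ball z (e * R))"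
      using disj by (intro emeasure_mono) (auto simp: P_def)
    also have "\<dots> = emeasure lborel (cball z R) - emeasure lborel (ball z (e * R))"
      using sub e R by (intro emeasure_Diff) (auto simp: emeasure_ball)
    also have "\<dots> = ennreal (unit_ball_vol ?n * R ^ ?n - unit_ball_vol ?n * (e * R) ^ ?n)"
      using e R by (simp add: emeasure_ball emeasure_cball ennreal_minus)
    also have "unit_ball_vol ?n * R ^ ?n - unit_ball_vol ?n * (e * R) ^ ?n
        = (1 - e ^ ?n) * (unit_ball_vol ?n * R ^ ?n)"
      by (simp add: power_mult_distrib algebra_simps)
    also have "ennreal \<dots> = ennreal (1 - e ^ ?n) * emeasure lborel (cball z R)"
      using e R by (simp add: emeasure_cball ennreal_mult power_le_one)
    finally show "\<exists>z r. 0 < r \<and> r < d \<and> x \<in> cball z r \<and>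
        emeasure lborel (P \<inter> cball z r) \<le> ennreal (1 - e ^ ?n) * emeasure lborel (cball z r)"
      using R z(1) k by (intro exI[of _ z] exI[of _ R]) (simp add: R_def)
  qed
  then show ?thesis
  proof (rule AE_I')
    show "{x \<in> space lborel. \<not> (x \<in> A \<longrightarrow> (\<exists>d>0. \<forall>z. dist z x < d \<longrightarrow> infdist z A \<le> e * dist z x))} \<subseteq> P"
      (is "?N \<subseteq> P")
    proof
      fix x assume "x \<in> ?N"
      then have x: "x \<in> A" and H: "\<not> (\<exists>d>0. \<forall>z. dist z x < d \<longrightarrow> infdist z A \<le> e * dist z x)"
        by blast+
      have "x \<in> W k" for k
      proof -
        have "0 < inverse (real (Suc k))" by simp
        with H obtain z where "dist z x < inverse (real (Suc k))" "\<not> infdist z A \<le> e * dist z x"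
          by blast
        then show ?thesis unfolding W_def by (auto simp: not_le)
      qed
      then show "x \<in> P" using x by (simp add: P_def)
    qed
  qed
qed

section \<open>Rademacher's theorem\<close>

text \<open>On the small intervals witnessing a slope above \<open>q\<close>, the Stieltjes measure
  of \<open>g\<close> exceeds \<open>q\<close> times the length; so it can serve, scaled by
  \<open>1 / q\<close>, as the comparison measure in the Vitali argument.\<close>

lemma emeasure_steep_points_le:
  fixes g :: "real \<Rightarrow> real"
  assumes g: "mono g" "continuous_on UNIV g" and A: "A \<in> sets borel" and q: "0 < q" and ab: "a \<le> b"
    and steep: "\<And>x d. x \<in> A \<Longrightarrow> 0 < d \<Longrightarrow> \<exists>t. t \<noteq> 0 \<and> \<bar>t\<bar> < d \<and> q < (g (x + t) - g x) / t"
  shows "emeasure lborel (A \<inter> {a..b}) \<le> ennreal ((g b - g a) / q)"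
proof -
  let ?\<nu> = "scale_measure (ennreal (1 / q)) (interval_measure g)"
  have mono: "g x \<le> g y" if "x \<le> y" for x y using g(1) that by (rule monoD)
  have rc: "continuous (at_right x) g" for x
    using g(2) by (auto simp: continuous_on_eq_continuous_at intro: continuous_at_imp_continuous_at_within)
  \<comment> \<open>The comparison takes place inside an open set, so the two endpoints are dropped
    at no cost.\<close>
  have "AE x in lborel. x \<noteq> a \<and> x \<noteq> b"
    using AE_lborel_singleton[of a] AE_lborel_singleton[of b] by eventually_elim auto
  then have "AE x in lborel. x \<in> A \<inter> {a..b} \<longleftrightarrow> x \<in> A \<inter> {a<..<b}"
    by (rule eventually_mono) auto
  then have "emeasure lborel (A \<inter> {a..b}) = emeasure lborel (A \<inter> {a<..<b})"
    using A by (intro emeasure_eq_AE) auto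
  also have "\<dots> \<le> emeasure ?\<nu> {a<..<b}"
  proof (rule emeasure_lborel_le_Vitali)
    fix x and d :: real assume x: "x \<in> A \<inter> {a<..<b}" and d: "0 < d"
    obtain t where t: "t \<noteq> 0" "\<bar>t\<bar> < d" "q < (g (x + t) - g x) / t"
      using steep[of x d] x d by blast
    define l r where "l = min x (x + t)" and "r = max x (x + t)"
    have lr: "l \<le> r" "r - l = \<bar>t\<bar>" by (auto simp: l_def r_def)
    have cb: "cball (x + t / 2) (\<bar>t\<bar> / 2) = {l..r}"
      by (auto simp: cball_eq_atLeastAtMost l_def r_def)
    have "q * (r - l) \<le> g r - g l"
      using t by (cases "t > 0") (auto simp: l_def r_def field_simps)
    then have "r - l \<le> (g r - g l) / q" using q by (simp add: field_simps)
    then have "ennreal (r - l) \<le> ennreal (1 / q) * ennreal (g r - g l)"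
      using q mono[OF lr(1)] by (simp flip: ennreal_mult)
    moreover have "emeasure (interval_measure g) {l..r} = ennreal (g r - g l)"
      using lr(1) mono g(2) by (intro emeasure_interval_measure_Icc) auto
    moreover have "emeasure lborel (A \<inter> {a<..<b} \<inter> {l..r}) \<le> emeasure lborel {l..r}"
      by (intro emeasure_mono) auto
    ultimately have "emeasure lborel (A \<inter> {a<..<b} \<inter> {l..r}) \<le> emeasure ?\<nu> {l..r}"
      using lr(1) by simp
    then show "\<exists>z r. 0 < r \<and> r < d \<and> x \<in> cball z r \<and>
        emeasure lborel (A \<inter> {a<..<b} \<inter> cball z r) \<le> emeasure ?\<nu> (cball z r)"
      using t cb by (intro exI[of _ "x + t / 2"] exI[of _ "\<bar>t\<bar> / 2"]) (auto simp: l_def r_def)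
  qed (use A in auto)
  also have "\<dots> \<le> emeasure ?\<nu> {a<..b}"
    by (intro emeasure_mono) auto
  also have "\<dots> = ennreal (1 / q) * ennreal (g b - g a)"
    using emeasure_interval_measure_Ioc[OF ab mono rc] by simp
  also have "\<dots> = ennreal ((g b - g a) / q)"
    using q mono[OF ab] by (simp flip: ennreal_mult)
  finally show ?thesis .
qed

text \<open>Lebesgue's argument: in an interval of mean slope below \<open>p\<close>, the points
  with slopes above \<open>q\<close> at all small scales fill at most the fraction
  \<open>p / q\<close>. So the points whose difference quotients oscillate across two rational
  levels form a null set.\<close>

lemma AE_differentiable_lipschitz_real:
  fixes f :: "real \<Rightarrow> real"
  assumes f: "L-lipschitz_on UNIV f"
  shows "AE x in lborel. \<exists>D. (f has_real_derivative D) (at x)"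
proof -
  have L: "0 \<le> L" using f by (rule lipschitz_on_nonneg)
  \<comment> \<open>Slopes of at least 1 make \<open>g\<close> increasing and force every level
    above the lower limit to be positive, as the quotient \<open>p / q\<close> requires.\<close>
  define g where "g x = f x + (L + 1) * x" for x
  define s where "s x t = (g (x + t) - g x) / t" for x t
  have f_le: "\<bar>f x - f y\<bar> \<le> L * \<bar>x - y\<bar>" for x y
    using lipschitz_onD[OF f, of x y] by (simp add: dist_real_def)
  have s_eq: "s x t = (f (x + t) - f x) / t + (L + 1)" if "t \<noteq> 0" for x t
    using that by (simp add: s_def g_def field_simps)
  have f_q: "\<bar>(f (x + t) - f x) / t\<bar> \<le> L" if "t \<noteq> 0" for x t
    using f_le[of "x + t" x] that by (simp add: field_simps)
  have s_bounds: "1 \<le> s x t" "s x t \<le> 2 * L + 1" if "t \<noteq> 0" for x t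
    using f_q[OF that, of x] s_eq[OF that, of x] by linarith+
  have cont: "continuous_on UNIV g"
    unfolding g_def by (intro continuous_intros lipschitz_on_continuous_on[OF f])
  have "mono g"
  proof (rule monoI)
    fix x y :: real assume "x \<le> y"
    show "g x \<le> g y"
    proof (cases "x = y")
      case False
      then have "1 \<le> s x (y - x)" by (intro s_bounds) auto
      then show ?thesis using False \<open>x \<le> y\<close> by (simp add: s_def field_simps)
    qed auto
  qed
  define W where "W p k = (\<Union>t\<in>{t. t \<noteq> 0 \<and> \<bar>t\<bar> < inverse (real (Suc k))}. {x. s x t < p})" for p k
  define W' where "W' q k = (\<Union>t\<in>{t. t \<noteq> 0 \<and> \<bar>t\<bar> < inverse (real (Suc k))}. {x. q < s x t})" for q k
  define A where "A p q = (\<Inter>k. W p k) \<inter> (\<Inter>k. W' q k)" for p q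
  have cs: "continuous_on UNIV (\<lambda>x. s x t)" for t
    unfolding s_def divide_inverse
    by (intro continuous_intros continuous_on_compose2[OF cont]) auto
  have "open (W p k)" "open (W' p k)" for p k
    unfolding W_def W'_def by (intro open_UN ballI open_Collect_less cs continuous_intros)+
  then have A: "A p q \<in> sets borel" for p q
    unfolding A_def by (intro sets.Int sets.countable_INT') auto
  have low: "\<exists>t. t \<noteq> 0 \<and> \<bar>t\<bar> < d \<and> s x t < p" and high: "\<exists>t. t \<noteq> 0 \<and> \<bar>t\<bar> < d \<and> q < s x t"
    if "x \<in> A p q" "0 < d" for x p q d
  proof -
    obtain k where k: "inverse (real (Suc k)) < d" using reals_Archimedean[OF \<open>0 < d\<close>] by auto
    have "x \<in> W p k" "x \<in> W' q k" using that by (auto simp: A_def)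
    then show "\<exists>t. t \<noteq> 0 \<and> \<bar>t\<bar> < d \<and> s x t < p" "\<exists>t. t \<noteq> 0 \<and> \<bar>t\<bar> < d \<and> q < s x t"
      using k unfolding W_def W'_def by (auto intro: less_trans)
  qed
  have null: "A p q \<in> null_sets lborel" if pq: "0 < p" "p < q" for p q
  proof (rule null_sets_lborel_if_sparse[OF A, of "p / q"])
    show "0 \<le> p / q" "p / q < 1" using pq by auto
  next
    fix x d :: real assume x: "x \<in> A p q" and d: "0 < d"
    obtain t where t: "t \<noteq> 0" "\<bar>t\<bar> < d" "s x t < p" using low[OF x d] by blast
    define l r where "l = min x (x + t)" and "r = max x (x + t)"
    have lr: "l \<le> r" "r - l = \<bar>t\<bar>" by (auto simp: l_def r_def)
    have cb: "cball (x + t / 2) (\<bar>t\<bar> / 2) = {l..r}"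
      by (auto simp: cball_eq_atLeastAtMost l_def r_def)
    have gp: "g r - g l \<le> p * (r - l)"
      using t by (cases "t > 0") (auto simp: s_def l_def r_def field_simps)
    have "emeasure lborel (A p q \<inter> {l..r}) \<le> ennreal ((g r - g l) / q)"
      using pq lr(1) high by (intro emeasure_steep_points_le[OF \<open>mono g\<close> cont A]) (auto simp: s_def)
    also have "\<dots> \<le> ennreal (p / q * (r - l))"
      using divide_right_mono[OF gp, of q] pq by (intro ennreal_leI) simp
    also have "\<dots> = ennreal (p / q) * emeasure lborel {l..r}"
      using lr(1) pq ennreal_mult[of "p / q" "r - l"] by simp
    finally show "\<exists>z r. 0 < r \<and> r < d \<and> x \<in> cball z r \<and>
        emeasure lborel (A p q \<inter> cball z r) \<le> ennreal (p / q) * emeasure lborel (cball z r)"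
      using t cb by (intro exI[of _ "x + t / 2"] exI[of _ "\<bar>t\<bar> / 2"]) (auto simp: l_def r_def)
  qed
  have deriv: "\<exists>D. (f has_real_derivative D) (at x)"
    if x: "\<And>p q :: rat. 0 < p \<Longrightarrow> p < q \<Longrightarrow> x \<notin> A (real_of_rat p) (real_of_rat q)" for x
  proof -
    let ?l = "Liminf (at 0) (\<lambda>t. ereal (s x t))" and ?u = "Limsup (at 0) (\<lambda>t. ereal (s x t))"
    have ev: "\<forall>\<^sub>F t in at 0. 1 \<le> s x t \<and> s x t \<le> 2 * L + 1"
      using s_bounds by (auto simp: eventually_at intro!: exI[of _ 1])
    have l1: "1 \<le> ?l"
      using ev by (intro Liminf_bounded) (auto elim!: eventually_mono)
    have u1: "?u \<le> ereal (2 * L + 1)"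
      using ev by (intro Limsup_bounded) (auto elim!: eventually_mono)
    have lu: "?l \<le> ?u" by (intro Liminf_le_Limsup) simp
    have "\<not> ?l < ?u"
    proof
      assume "?l < ?u"
      then obtain q where q: "?l < ereal (real_of_rat q)" "ereal (real_of_rat q) < ?u"
        using ereal_dense3 by blast
      then obtain p where p: "?l < ereal (real_of_rat p)" "ereal (real_of_rat p) < ereal (real_of_rat q)"
        using ereal_dense3 by blast
      have "1 < real_of_rat p" using l1 p(1) by (metis ereal_less(3) ereal_less_eq(3) less_ereal.simps(1) one_ereal_def order_le_less_trans)
      then have p0: "0 < p" "p < q" using p(2) by (auto simp: of_rat_less)
      have "x \<in> W (real_of_rat p) k" for k
      proof (rule ccontr)
        assume "x \<notin> W (real_of_rat p) k"
        then have "\<forall>\<^sub>F t in at 0. ereal (real_of_rat p) \<le> ereal (s x t)"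
          unfolding W_def by (auto simp: eventually_at not_less intro!: exI[of _ "inverse (real (Suc k))"])
        then have "ereal (real_of_rat p) \<le> ?l" by (rule Liminf_bounded)
        then show False using p(1) by simp
      qed
      moreover have "x \<in> W' (real_of_rat q) k" for k
      proof (rule ccontr)
        assume "x \<notin> W' (real_of_rat q) k"
        then have "\<forall>\<^sub>F t in at 0. ereal (s x t) \<le> ereal (real_of_rat q)"
          unfolding W'_def by (auto simp: eventually_at not_less intro!: exI[of _ "inverse (real (Suc k))"])
        then have "?u \<le> ereal (real_of_rat q)" by (rule Limsup_bounded)
        then show False using q(2) by simp
      qed
      ultimately show False using x[OF p0] by (simp add: A_def)
    qed
    then have "?l = ?u" using lu by simp
    then have lim: "((\<lambda>t. ereal (s x t)) \<longlongrightarrow> ?l) (at 0)"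
      by (intro Liminf_eq_Limsup) auto
    have "\<exists>D. v = ereal D" if "1 \<le> v" "v \<le> ereal c" for v c
      using that by (cases v) auto
    then obtain D where "?l = ereal D"
      using l1 u1 lu by (meson order_trans)
    with lim have "(s x \<longlongrightarrow> D) (at 0)" by simp
    then have "(g has_real_derivative D) (at x)"
      unfolding DERIV_def s_def .
    then have "((\<lambda>x. g x - (L + 1) * x) has_real_derivative (D - (L + 1))) (at x)"
      by (auto intro!: derivative_eq_intros)
    then show ?thesis by (auto simp: g_def)
  qed
  have "AE x in lborel. \<forall>p q :: rat. 0 < p \<and> p < q \<longrightarrow> x \<notin> A (real_of_rat p) (real_of_rat q)"
  proof (subst AE_all_countable, intro allI, subst AE_all_countable, intro allI)
    fix p q :: rat
    show "AE x in lborel. 0 < p \<and> p < q \<longrightarrow> x \<notin> A (real_of_rat p) (real_of_rat q)"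
    proof (cases "0 < p \<and> p < q")
      case True
      then have "A (real_of_rat p) (real_of_rat q) \<in> null_sets lborel"
        by (intro null) (auto simp: of_rat_less)
      then show ?thesis by (auto dest: AE_not_in)
    qed auto
  qed
  then show ?thesis by (rule eventually_mono) (blast intro: deriv)
qed

section \<open>Null sets seen along parallel lines\<close>

lemma AE_lborel_translate_iff:
  fixes Z :: "'a::euclidean_space set"
  assumes Z: "Z \<in> sets borel"
  shows "(AE y in lborel. y + v \<notin> Z) \<longleftrightarrow> Z \<in> null_sets lborel"
proof -
  have "Z \<in> null_sets lborel \<longleftrightarrow> (AE y in distr lborel borel ((+) v). y \<notin> Z)"
    using Z by (subst lborel_distr_plus) (simp add: AE_iff_null_sets)
  also have "\<dots> \<longleftrightarrow> (AE y in lborel. v + y \<notin> Z)"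
    using Z by (subst AE_distr_iff) (auto intro!: borel_measurable_continuous_onI continuous_intros)
  finally show ?thesis by (simp add: add.commute)
qed

text \<open>After exchanging the two quantifiers by Fubini, each fixed \<open>s\<close> merely
  translates \<open>Z\<close>. One direction proves exceptional sets null by testing them on lines,
  the other finds lines that avoid a given null set almost everywhere.\<close>

lemma AE_line_iff_null_sets:
  fixes Z :: "'a::euclidean_space set"
  assumes Z: "Z \<in> sets borel"
  shows "(AE y in lborel. AE s::real in lborel. y + s *\<^sub>R u \<notin> Z) \<longleftrightarrow> Z \<in> null_sets lborel"
proof -
  let ?M = "(lborel :: 'a measure) \<Otimes>\<^sub>M (lborel :: real measure)"
  have "(\<lambda>x. fst x + snd x *\<^sub>R u) \<in> borel_measurable ?M"
    by measurable
  then have "(\<lambda>x. fst x + snd x *\<^sub>R u) -` (- Z) \<inter> space ?M \<in> sets ?M"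
    using Z by (intro measurable_sets[of _ _ borel]) auto
  also have "(\<lambda>x. fst x + snd x *\<^sub>R u) -` (- Z) \<inter> space ?M = {x \<in> space ?M. fst x + snd x *\<^sub>R u \<notin> Z}"
    by auto
  finally have "(AE y in lborel. AE s::real in lborel. y + s *\<^sub>R u \<notin> Z)
      \<longleftrightarrow> (AE s::real in lborel. AE y in lborel. y + s *\<^sub>R u \<notin> Z)"
    by (rule lborel_pair.AE_commute)
  also have "\<dots> \<longleftrightarrow> Z \<in> null_sets lborel"
    by (simp add: AE_lborel_translate_iff[OF Z] eventually_const ae_filter_eq_bot_iff emeasure_lborel_UNIV)
  finally show ?thesis .
qed

lemma lipschitz_on_line:
  fixes F :: "'a::real_normed_vector \<Rightarrow> 'b::metric_space"
  assumes F: "L-lipschitz_on UNIV F"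
  shows "(L * norm u)-lipschitz_on UNIV (\<lambda>s::real. F (y + s *\<^sub>R u))"
proof (rule lipschitz_onI)
  fix s t :: real
  have "dist (F (y + s *\<^sub>R u)) (F (y + t *\<^sub>R u)) \<le> L * dist (y + s *\<^sub>R u) (y + t *\<^sub>R u)"
    by (rule lipschitz_onD[OF F]) auto
  also have "dist (y + s *\<^sub>R u) (y + t *\<^sub>R u) = norm u * dist s t"
    by (simp add: dist_norm flip: scaleR_diff_left)
  finally show "dist (F (y + s *\<^sub>R u)) (F (y + t *\<^sub>R u)) \<le> L * norm u * dist s t"
    by (simp add: algebra_simps)
qed (use lipschitz_on_nonneg[OF F] in simp)

text \<open>The difference quotient is multiplied out, which makes the condition closed in
  \<open>y\<close> and trivial at \<open>t = 0\<close>. Tolerance and scale are inverse naturals and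
  \<open>D\<close> will be rational, so countably many closed sets suffice.\<close>

definition partial_slope_set :: "('a::euclidean_space \<Rightarrow> real) \<Rightarrow> 'a \<Rightarrow> real \<Rightarrow> nat \<Rightarrow> nat \<Rightarrow> 'a set" where
  "partial_slope_set F u D m k =
     {y. \<forall>t. \<bar>t\<bar> < inverse (real (Suc k)) \<longrightarrow> \<bar>F (y + t *\<^sub>R u) - F y - D * t\<bar> \<le> inverse (real (Suc m)) * \<bar>t\<bar>}"

lemma closed_partial_slope_set:
  assumes F: "continuous_on UNIV F"
  shows "closed (partial_slope_set F u D m k)"
proof -
  have "partial_slope_set F u D m k = (\<Inter>t\<in>{t. \<bar>t\<bar> < inverse (real (Suc k))}.
      {y. \<bar>F (y + t *\<^sub>R u) - F y - D * t\<bar> \<le> inverse (real (Suc m)) * \<bar>t\<bar>})"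
    by (auto simp: partial_slope_set_def)
  also have "closed \<dots>"
    by (intro closed_INT ballI closed_Collect_le continuous_intros continuous_on_compose2[OF F]) auto
  finally show ?thesis .
qed

text \<open>On every line in direction \<open>u\<close> the restriction of \<open>F\<close> is
  Lipschitz, hence differentiable almost everywhere, and a rational near the derivative serves as
  \<open>D\<close>.\<close>

lemma AE_partial_slope_set:
  fixes F :: "'a::euclidean_space \<Rightarrow> real"
  assumes F: "L-lipschitz_on UNIV F"
  shows "AE y in lborel. \<exists>(D::rat) k. y \<in> partial_slope_set F u (real_of_rat D) m k"
proof -
  define Z where "Z = - (\<Union>D::rat. \<Union>k. partial_slope_set F u (real_of_rat D) m k)"
  have cont: "continuous_on UNIV F" using F by (rule lipschitz_on_continuous_on)
  have Z: "Z \<in> sets borel"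
    unfolding Z_def by (intro borel_comp sets.countable_UN'' borel_closed closed_partial_slope_set cont) auto
  have "AE s::real in lborel. y + s *\<^sub>R u \<notin> Z" for y
  proof -
    from AE_differentiable_lipschitz_real[OF lipschitz_on_line[OF F]] show ?thesis
    proof (rule eventually_mono)
      fix s :: real assume "\<exists>D. ((\<lambda>s. F (y + s *\<^sub>R u)) has_real_derivative D) (at s)"
      then obtain D where D: "(\<lambda>t. (F (y + (s + t) *\<^sub>R u) - F (y + s *\<^sub>R u)) / t) \<midarrow>0\<rightarrow> D"
        unfolding DERIV_def by blast
      \<comment> \<open>Half of the tolerance goes to the limit of the quotients, half to replacing
        the derivative by a rational.\<close>
      define e where "e = inverse (real (Suc m)) / 2"
      have e: "e > 0" by (simp add: e_def)
      obtain q :: rat where q: "D - e < real_of_rat q" "real_of_rat q < D + e"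
        using of_rat_dense[of "D - e" "D + e"] e by auto
      obtain d where d: "d > 0" "\<And>t. t \<noteq> 0 \<Longrightarrow> \<bar>t\<bar> < d \<Longrightarrow>
          \<bar>(F (y + (s + t) *\<^sub>R u) - F (y + s *\<^sub>R u)) / t - D\<bar> < e"
        using LIM_D[OF D e] by auto
      obtain k where k: "inverse (real (Suc k)) < d" using reals_Archimedean[OF d(1)] by auto
      have "\<bar>F (y + s *\<^sub>R u + t *\<^sub>R u) - F (y + s *\<^sub>R u) - real_of_rat q * t\<bar> \<le> inverse (real (Suc m)) * \<bar>t\<bar>"
        if t: "\<bar>t\<bar> < inverse (real (Suc k))" for t
      proof (cases "t = 0")
        case False
        define Q where "Q = (F (y + (s + t) *\<^sub>R u) - F (y + s *\<^sub>R u)) / t"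
        have "\<bar>Q - D\<bar> < e" unfolding Q_def using t k False by (intro d) auto
        then have "\<bar>Q - real_of_rat q\<bar> \<le> inverse (real (Suc m))"
          using q unfolding e_def by linarith
        then have "\<bar>Q - real_of_rat q\<bar> * \<bar>t\<bar> \<le> inverse (real (Suc m)) * \<bar>t\<bar>"
          by (intro mult_right_mono) auto
        moreover have "\<bar>Q - real_of_rat q\<bar> * \<bar>t\<bar> = \<bar>Q * t - real_of_rat q * t\<bar>"
          by (simp add: left_diff_distrib flip: abs_mult)
        moreover have "Q * t = F (y + s *\<^sub>R u + t *\<^sub>R u) - F (y + s *\<^sub>R u)"
          using False by (simp add: Q_def scaleR_left_distrib add.assoc)
        ultimately show ?thesis by simp
      qed auto
      then show "y + s *\<^sub>R u \<notin> Z"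
        by (auto simp: Z_def partial_slope_set_def)
    qed
  qed
  then have "Z \<in> null_sets lborel"
    using AE_line_iff_null_sets[OF Z, of u] by simp
  then have "AE y in lborel. y \<notin> Z" by (rule AE_not_in)
  then show ?thesis by (rule eventually_mono) (auto simp: Z_def)
qed

text \<open>By non-porosity, a point near \<^term>\<open>y\<close> is much closer to a point of the slope set of \<^term>\<open>y\<close>
  than to \<^term>\<open>y\<close> itself, so the partial slope at \<^term>\<open>y\<close> also governs increments starting nearby.
  These add up along the coordinate directions, which yields the total derivative.\<close>
lemma AE_strong_partial_derivative:
  fixes F :: "'a::euclidean_space \<Rightarrow> real"
  assumes F: "L-lipschitz_on UNIV F"
  shows "AE y in lborel. \<forall>e>0. \<exists>D. \<exists>d>0. \<forall>z t. dist z y < d \<and> \<bar>t\<bar> < d \<longrightarrow>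
           \<bar>F (z + t *\<^sub>R u) - F z - D * t\<bar> \<le> e * (\<bar>t\<bar> + dist z y)"
proof -
  have cont: "continuous_on UNIV F" using F by (rule lipschitz_on_continuous_on)
  have L: "0 \<le> L" using F by (rule lipschitz_on_nonneg)
  have "AE y in lborel. \<forall>m. \<exists>(D::rat) k. y \<in> partial_slope_set F u (real_of_rat D) m k"
    using AE_partial_slope_set[OF F] by (simp add: AE_all_countable)
  \<comment> \<open>Non-porosity needs a ratio below 1, which \<open>inverse (real (Suc m))\<close>
    misses for \<open>m = 0\<close>; hence the double \<open>Suc\<close>.\<close>
  moreover have "AE y in lborel. \<forall>m k. \<forall>D::rat. y \<in> partial_slope_set F u (real_of_rat D) m k \<longrightarrow>
      (\<exists>d>0. \<forall>z. dist z y < d \<longrightarrow> infdist z (partial_slope_set F u (real_of_rat D) m k)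
         \<le> inverse (real (Suc (Suc m))) * dist z y)"
    unfolding AE_all_countable
    by (intro allI AE_closed_not_porous closed_partial_slope_set cont) (auto simp: field_simps)
  ultimately show ?thesis
  proof eventually_elim
    case (elim y)
    show ?case
    proof (intro allI impI)
      fix e :: real assume e: "e > 0"
      \<comment> \<open>The 1 covers the slope error at the nearby point \<open>w\<close> of the
        slope set, \<open>2 * L\<close> the two Lipschitz comparisons between \<open>z\<close> and
        \<open>w\<close>.\<close>
      define c where "c = 1 + 2 * L"
      have c: "c > 0" using L by (simp add: c_def)
      obtain m where m: "inverse (real (Suc m)) < e / c"
        using reals_Archimedean[of "e / c"] e c by auto
      define \<mu> where "\<mu> = inverse (real (Suc m))"
      have \<mu>: "0 < \<mu>" "\<mu> * c \<le> e" using m c by (auto simp: \<mu>_def field_simps)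
      have \<mu>': "inverse (real (Suc (Suc m))) \<le> \<mu>" by (simp add: \<mu>_def field_simps)
      obtain D :: rat and k where y: "y \<in> partial_slope_set F u (real_of_rat D) m k"
        using elim(1) by blast
      let ?A = "partial_slope_set F u (real_of_rat D) m k"
      obtain d where d: "d > 0" "\<And>z. dist z y < d \<Longrightarrow> infdist z ?A \<le> inverse (real (Suc (Suc m))) * dist z y"
        using elim(2) y by blast
      define d' where "d' = min d (inverse (real (Suc k)))"
      have "\<bar>F (z + t *\<^sub>R u) - F z - real_of_rat D * t\<bar> \<le> e * (\<bar>t\<bar> + dist z y)"
        if zt: "dist z y < d'" "\<bar>t\<bar> < d'" for z t
      proof -
        obtain w where w: "w \<in> ?A" "infdist z ?A = dist z w"
          using infdist_attains_inf[OF closed_partial_slope_set[OF cont]] y by blast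
        have "dist z w \<le> inverse (real (Suc (Suc m))) * dist z y"
          using d(2)[of z] zt w by (simp add: d'_def)
        also have "\<dots> \<le> \<mu> * dist z y" using \<mu>' by (intro mult_right_mono) auto
        finally have zw: "dist z w \<le> \<mu> * dist z y" .
        have Lzw: "L * dist z w \<le> L * (\<mu> * dist z y)" using zw L by (rule mult_left_mono)
        have "\<bar>F (w + t *\<^sub>R u) - F w - real_of_rat D * t\<bar> \<le> \<mu> * \<bar>t\<bar>"
          using w(1) zt by (auto simp: partial_slope_set_def d'_def \<mu>_def)
        moreover have "\<bar>F (z + t *\<^sub>R u) - F (w + t *\<^sub>R u)\<bar> \<le> L * dist z w" "\<bar>F z - F w\<bar> \<le> L * dist z w"
          using lipschitz_onD[OF F, of "z + t *\<^sub>R u" "w + t *\<^sub>R u"] lipschitz_onD[OF F, of z w]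
          by (auto simp: dist_real_def)
        ultimately have "\<bar>F (z + t *\<^sub>R u) - F z - real_of_rat D * t\<bar> \<le> \<mu> * \<bar>t\<bar> + 2 * (L * (\<mu> * dist z y))"
          using Lzw by linarith
        also have "\<dots> \<le> \<mu> * c * \<bar>t\<bar> + \<mu> * c * dist z y"
        proof -
          have "\<mu> * \<bar>t\<bar> \<le> \<mu> * c * \<bar>t\<bar>" using \<mu> L by (simp add: c_def mult_right_mono)
          moreover have "2 * (L * (\<mu> * dist z y)) \<le> \<mu> * c * dist z y"
            using \<mu> by (simp add: c_def algebra_simps)
          ultimately show ?thesis by linarith
        qed
        also have "\<dots> = \<mu> * c * (\<bar>t\<bar> + dist z y)" by (simp add: algebra_simps)
        also have "\<dots> \<le> e * (\<bar>t\<bar> + dist z y)" using \<mu>(2) by (intro mult_right_mono) auto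
        finally show ?thesis .
      qed
      moreover have "d' > 0" using d by (simp add: d'_def)
      ultimately show "\<exists>D. \<exists>d>0. \<forall>z t. dist z y < d \<and> \<bar>t\<bar> < d \<longrightarrow>
           \<bar>F (z + t *\<^sub>R u) - F z - D * t\<bar> \<le> e * (\<bar>t\<bar> + dist z y)"
        by blast
    qed
  qed
qed

text \<open>The increment is made one coordinate at a time. Each step starts at a point already
  displaced from \<open>y\<close> by the earlier ones, which is why the partial slopes have to hold
  at moving base points \<open>z\<close>.\<close>

lemma approx_gradient_if_strong_partial_derivatives:
  fixes F :: "'a::euclidean_space \<Rightarrow> real"
  assumes partial: "\<And>u e. u \<in> Basis \<Longrightarrow> e > 0 \<Longrightarrow> \<exists>D. \<exists>d>0. \<forall>z t. dist z y < d \<and> \<bar>t\<bar> < d \<longrightarrow>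
           \<bar>F (z + t *\<^sub>R u) - F z - D * t\<bar> \<le> e * (\<bar>t\<bar> + dist z y)"
    and e: "e > 0"
  shows "\<exists>a. \<exists>d>0. \<forall>h. norm h < d \<longrightarrow> \<bar>F (y + h) - F y - a \<bullet> h\<bar> \<le> e * norm h"
proof -
  define N where "N = real (DIM('a))"
  have N: "N > 0" by (simp add: N_def)
  \<comment> \<open>There are \<open>N\<close> steps, each with error at most
    \<open>\<mu> * (norm h + N * norm h)\<close>.\<close>
  define \<mu> where "\<mu> = e / (N * (1 + N))"
  have \<mu>: "\<mu> > 0" using e N by (simp add: \<mu>_def)
  have "\<exists>D d. \<forall>u\<in>Basis. d u > 0 \<and> (\<forall>z t. dist z y < d u \<and> \<bar>t\<bar> < d u \<longrightarrow>
           \<bar>F (z + t *\<^sub>R u) - F z - D u * t\<bar> \<le> \<mu> * (\<bar>t\<bar> + dist z y))"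
    using partial[OF _ \<mu>] by metis
  then obtain D d where d: "\<And>u. u \<in> Basis \<Longrightarrow> d u > 0"
    and D: "\<And>u z t. u \<in> Basis \<Longrightarrow> dist z y < d u \<Longrightarrow> \<bar>t\<bar> < d u \<Longrightarrow>
           \<bar>F (z + t *\<^sub>R u) - F z - D u * t\<bar> \<le> \<mu> * (\<bar>t\<bar> + dist z y)"
    by metis
  \<comment> \<open>Step length and displacement together stay below \<open>(1 + N) * d0\<close>,
    hence below every \<open>d b\<close>.\<close>
  define d0 where "d0 = Min (d ` Basis) / (1 + N)"
  have Min0: "Min (d ` Basis) > 0" using d by simp
  then have d0: "d0 > 0" using N by (simp add: d0_def)
  have part: "\<bar>F (y + (\<Sum>b\<in>S. (h \<bullet> b) *\<^sub>R b)) - F y - (\<Sum>b\<in>S. D b * (h \<bullet> b))\<bar> \<le> real (card S) * (\<mu> * ((1 + N) * norm h))"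
    if h: "norm h < d0" and S: "S \<subseteq> Basis" for h S
    using finite_subset[OF S finite_Basis] S
  proof (induction S rule: finite_induct)
    case (insert b S)
    let ?z = "y + (\<Sum>b\<in>S. (h \<bullet> b) *\<^sub>R b)"
    have b: "b \<in> Basis" and S: "S \<subseteq> Basis" using insert.prems by auto
    have "norm (\<Sum>b\<in>S. (h \<bullet> b) *\<^sub>R b) \<le> (\<Sum>b\<in>S. norm h)"
      using S by (intro sum_norm_le) (auto simp: Basis_le_norm)
    also have "\<dots> \<le> N * norm h"
      using card_mono[OF finite_Basis S] by (simp add: N_def mult_right_mono)
    finally have z: "dist ?z y \<le> N * norm h" by (simp add: dist_norm)
    have hb: "\<bar>h \<bullet> b\<bar> \<le> norm h" using b by (rule Basis_le_norm)
    have "(1 + N) * norm h < (1 + N) * d0" using h N by (intro mult_strict_left_mono) auto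
    also have "\<dots> = Min (d ` Basis)" using N by (simp add: d0_def)
    also have "\<dots> \<le> d b" using b by simp
    finally have small: "norm h + N * norm h < d b" by (simp add: algebra_simps)
    have "\<bar>F (?z + (h \<bullet> b) *\<^sub>R b) - F ?z - D b * (h \<bullet> b)\<bar> \<le> \<mu> * (\<bar>h \<bullet> b\<bar> + dist ?z y)"
      using small z hb N by (intro D b) (smt (verit) mult_nonneg_nonneg norm_ge_zero)+
    also have "\<dots> \<le> \<mu> * (norm h + N * norm h)"
      using hb z \<mu> by (intro mult_left_mono add_mono) auto
    finally have "\<bar>F (?z + (h \<bullet> b) *\<^sub>R b) - F ?z - D b * (h \<bullet> b)\<bar> \<le> \<mu> * ((1 + N) * norm h)"
      by (simp add: algebra_simps)
    moreover have "\<bar>F ?z - F y - (\<Sum>b\<in>S. D b * (h \<bullet> b))\<bar> \<le> real (card S) * (\<mu> * ((1 + N) * norm h))"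
      using insert.IH S by blast
    moreover have "F (y + (\<Sum>b\<in>insert b S. (h \<bullet> b) *\<^sub>R b)) = F (?z + (h \<bullet> b) *\<^sub>R b)"
      using insert.hyps by (simp add: algebra_simps)
    moreover have "(\<Sum>b\<in>insert b S. D b * (h \<bullet> b)) = (\<Sum>b\<in>S. D b * (h \<bullet> b)) + D b * (h \<bullet> b)"
      using insert.hyps by simp
    moreover have "real (card (insert b S)) * (\<mu> * ((1 + N) * norm h))
        = real (card S) * (\<mu> * ((1 + N) * norm h)) + \<mu> * ((1 + N) * norm h)"
      using insert.hyps by (simp add: algebra_simps)
    ultimately show ?case by linarith
  qed simp
  define a where "a = (\<Sum>b\<in>Basis. D b *\<^sub>R b)"
  have "\<bar>F (y + h) - F y - a \<bullet> h\<bar> \<le> e * norm h" if h: "norm h < d0" for h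
  proof -
    have "a \<bullet> h = (\<Sum>b\<in>Basis. D b * (h \<bullet> b))"
      by (simp add: a_def inner_sum_right inner_commute[of _ h])
    moreover have "N * (\<mu> * ((1 + N) * norm h)) = e * norm h"
      using N by (simp add: \<mu>_def)
    moreover have "\<bar>F (y + h) - F y - (\<Sum>b\<in>Basis. D b * (h \<bullet> b))\<bar> \<le> N * (\<mu> * ((1 + N) * norm h))"
      using part[OF h order_refl] by (simp only: euclidean_representation N_def)
    ultimately show ?thesis by linarith
  qed
  then show ?thesis using d0 by blast
qed

text \<open>The vector \<open>a\<close> may change with \<open>e\<close>. But two such vectors,
  tested on an increment along their difference, differ by at most the sum of their tolerances; so
  they form a Cauchy sequence, whose limit is the gradient.\<close>

lemma GDERIV_if_approx_gradients:
  fixes F :: "'a::euclidean_space \<Rightarrow> real"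
  assumes approx: "\<And>e. e > 0 \<Longrightarrow> \<exists>a. \<exists>d>0. \<forall>h. norm h < d \<longrightarrow> \<bar>F (y + h) - F y - a \<bullet> h\<bar> \<le> e * norm h"
  shows "\<exists>g. GDERIV F y :> g"
proof -
  define \<epsilon> where "\<epsilon> n = inverse (real (Suc n))" for n
  have \<epsilon>: "\<epsilon> n > 0" for n by (simp add: \<epsilon>_def)
  have "\<exists>a d. \<forall>n. d n > 0 \<and> (\<forall>h. norm h < d n \<longrightarrow> \<bar>F (y + h) - F y - a n \<bullet> h\<bar> \<le> \<epsilon> n * norm h)"
    using approx[OF \<epsilon>] by metis
  then obtain a d where d: "\<And>n. d n > 0"
    and a: "\<And>n h. norm h < d n \<Longrightarrow> \<bar>F (y + h) - F y - a n \<bullet> h\<bar> \<le> \<epsilon> n * norm h"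
    by metis
  have close: "norm (a m - a n) \<le> \<epsilon> m + \<epsilon> n" for m n
  proof (cases "a m = a n")
    case False
    define w where "w = a m - a n"
    have w: "norm w > 0" using False by (simp add: w_def)
    \<comment> \<open>The test increment \<open>t *\<^sub>R w\<close> gets half the smaller radius
      as its length, so both approximations apply to it.\<close>
    define t where "t = min (d m) (d n) / (2 * norm w)"
    have t: "t > 0" using d w by (simp add: t_def)
    have nt: "norm (t *\<^sub>R w) = min (d m) (d n) / 2" using w t d[of m] d[of n] by (simp add: t_def)
    have "\<bar>(a m - a n) \<bullet> (t *\<^sub>R w)\<bar> \<le> (\<epsilon> m + \<epsilon> n) * norm (t *\<^sub>R w)"
    proof -
      have "norm (t *\<^sub>R w) < d m" "norm (t *\<^sub>R w) < d n"
        unfolding nt using d[of m] d[of n] by auto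
      from a[OF this(1)] a[OF this(2)] show ?thesis
        by (simp only: inner_diff_left distrib_right)
    qed
    then have "t * (norm w * norm w) \<le> (\<epsilon> m + \<epsilon> n) * (t * norm w)"
      using t by (simp add: abs_mult dot_square_norm power2_eq_square flip: w_def)
    then have "(t * norm w) * norm w \<le> (t * norm w) * (\<epsilon> m + \<epsilon> n)"
      by (simp add: algebra_simps)
    then have "norm w \<le> \<epsilon> m + \<epsilon> n"
      using mult_pos_pos[OF t w] by (simp only: mult_le_cancel_left_pos)
    then show ?thesis by (simp only: w_def)
  qed (use \<epsilon>[of m] \<epsilon>[of n] in simp)
  have \<epsilon>0: "\<epsilon> \<longlonglongrightarrow> 0" unfolding \<epsilon>_def by (rule LIMSEQ_inverse_real_of_nat)
  have "Cauchy a"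
  proof (rule metric_CauchyI)
    fix e :: real assume "e > 0"
    then obtain M where M: "\<And>n. n \<ge> M \<Longrightarrow> \<epsilon> n < e / 2"
      using order_tendstoD(2)[OF \<epsilon>0, of "e / 2"] by (auto simp: eventually_sequentially)
    have "dist (a m) (a n) < e" if "m \<ge> M" "n \<ge> M" for m n
      using close[of m n] M[OF that(1)] M[OF that(2)] by (simp add: dist_norm)
    then show "\<exists>M. \<forall>m\<ge>M. \<forall>n\<ge>M. dist (a m) (a n) < e" by blast
  qed
  then obtain g where g: "a \<longlonglongrightarrow> g" using Cauchy_convergent convergent_def by blast
  have close_g: "norm (a m - g) \<le> \<epsilon> m" for m
  proof (rule LIMSEQ_le)
    show "(\<lambda>n. norm (a m - a n)) \<longlonglongrightarrow> norm (a m - g)" by (intro tendsto_intros g)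
    show "(\<lambda>n. \<epsilon> m + \<epsilon> n) \<longlonglongrightarrow> \<epsilon> m" using tendsto_add[OF tendsto_const \<epsilon>0] by simp
  qed (use close in blast)
  have "(F has_derivative (\<lambda>h. h \<bullet> g)) (at y)"
    unfolding has_derivative_at_alt
  proof (intro conjI allI impI)
    fix e :: real assume "e > 0"
    then obtain n where n: "\<epsilon> n < e / 2"
      using reals_Archimedean[of "e / 2"] by (auto simp: \<epsilon>_def)
    have "norm (F z - F y - (z - y) \<bullet> g) \<le> e * norm (z - y)" if z: "norm (z - y) < d n" for z
    proof -
      have "\<bar>F z - F y - a n \<bullet> (z - y)\<bar> \<le> \<epsilon> n * norm (z - y)"
        using a[OF z] by simp
      moreover have "\<bar>(a n - g) \<bullet> (z - y)\<bar> \<le> \<epsilon> n * norm (z - y)"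
        using Cauchy_Schwarz_ineq2 close_g by (meson mult_right_mono norm_ge_zero order_trans)
      moreover have "(a n - g) \<bullet> (z - y) = a n \<bullet> (z - y) - (z - y) \<bullet> g"
        by (simp add: inner_diff_left inner_diff_right inner_commute)
      ultimately have "\<bar>F z - F y - (z - y) \<bullet> g\<bar> \<le> 2 * \<epsilon> n * norm (z - y)" by linarith
      also have "\<dots> \<le> e * norm (z - y)" using n by (intro mult_right_mono) auto
      finally show ?thesis by simp
    qed
    then show "\<exists>d>0. \<forall>z. norm (z - y) < d \<longrightarrow> norm (F z - F y - (z - y) \<bullet> g) \<le> e * norm (z - y)"
      using d by blast
  qed (rule bounded_linear_inner_left)
  then show ?thesis by (auto simp: gderiv_def)
qed

theorem Rademacher:
  fixes F :: "'a::euclidean_space \<Rightarrow> real"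
  assumes F: "L-lipschitz_on UNIV F"
  shows "AE y in lborel. \<exists>g. GDERIV F y :> g"
proof -
  have "AE y in lborel. \<forall>u\<in>Basis. \<forall>e>0. \<exists>D. \<exists>d>0. \<forall>z t. dist z y < d \<and> \<bar>t\<bar> < d \<longrightarrow>
           \<bar>F (z + t *\<^sub>R u) - F z - D * t\<bar> \<le> e * (\<bar>t\<bar> + dist z y)"
    by (intro AE_finite_allI finite_Basis AE_strong_partial_derivative[OF F])
  then show ?thesis
    by (rule eventually_mono)
       (intro GDERIV_if_approx_gradients approx_gradient_if_strong_partial_derivatives, auto)
qed

section \<open>Growth of absolutely continuous functions\<close>

lemma division_of_real_intervalE:
  fixes d :: "real set set"
  assumes "d division_of t" "k \<in> d" "t \<subseteq> {a..b}"
  obtains "k = {Inf k..Sup k}" "Inf k \<le> Sup k" "Inf k \<in> {a..b}" "Sup k \<in> {a..b}"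
proof -
  have "k \<subseteq> t" "k \<noteq> {}" "\<exists>u v. k = cbox u v"
    using division_ofD(2-4)[OF assms(1,2)] by auto
  then obtain u v where uv: "k = {u..v}" "u \<le> v" by auto
  then have "Inf k = u" "Sup k = v" by auto
  moreover have "u \<in> k" "v \<in> k" using uv by auto
  moreover from this have "u \<in> {a..b}" "v \<in> {a..b}" using \<open>k \<subseteq> t\<close> assms(3) by blast+
  ultimately show ?thesis using uv by (intro that) auto
qed

lemma abs_cont_on_interval_imp_continuous_on:
  fixes f :: "real \<Rightarrow> 'a::real_normed_vector"
  assumes "abs_cont_on_interval a b f"
  shows "continuous_on {a..b} f"
  unfolding continuous_on_iff
proof (intro ballI allI impI)
  fix x and e :: real assume x: "x \<in> {a..b}" and e: "e > 0"
  obtain \<delta> where \<delta>: "\<delta> > 0" "\<And>d t. d division_of t \<Longrightarrow> t \<subseteq> {a..b} \<Longrightarrow> (\<Sum>k\<in>d. Sup k - Inf k) < \<delta> \<Longrightarrow>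
        (\<Sum>k\<in>d. norm (f (Sup k) - f (Inf k))) < e"
    using assms e unfolding abs_cont_on_interval_def by metis
  have "dist (f y) (f x) < e" if y: "y \<in> {a..b}" "dist y x < \<delta>" for y
  proof -
    let ?k = "{min x y..max x y}"
    have "{cbox (min x y) (max x y)} division_of cbox (min x y) (max x y)"
      by (rule division_of_self) (simp add: min_def max_def)
    then have "{?k} division_of ?k" by simp
    moreover have "?k \<subseteq> {a..b}" using x y by auto
    ultimately have "norm (f (Sup ?k) - f (Inf ?k)) < e"
      using \<delta>(2)[of "{?k}" ?k] y(2) by (auto simp: dist_real_def)
    then show ?thesis by (cases "x \<le> y") (auto simp: dist_norm norm_minus_commute)
  qed
  then show "\<exists>d>0. \<forall>y\<in>{a..b}. dist y x < d \<longrightarrow> dist (f y) (f x) < e"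
    using \<delta>(1) by blast
qed

text \<open>The Lipschitz condition is asked only on a set containing the curve, because
  \<open>B\<close> will be Lipschitz only near a given point.\<close>

lemma abs_cont_on_interval_lipschitz_compose:
  assumes f: "abs_cont_on_interval a b f" and g: "L-lipschitz_on S g" and fS: "f ` {a..b} \<subseteq> S"
  shows "abs_cont_on_interval a b (\<lambda>t. g (f t))"
  unfolding abs_cont_on_interval_def
proof (intro allI impI)
  fix e :: real assume e: "e > 0"
  have L: "0 \<le> L" using g by (rule lipschitz_on_nonneg)
  then have "e / (L + 1) > 0" using e by simp
  then obtain \<delta> where \<delta>: "\<delta> > 0" "\<And>d t. d division_of t \<Longrightarrow> t \<subseteq> {a..b} \<Longrightarrow> (\<Sum>k\<in>d. Sup k - Inf k) < \<delta> \<Longrightarrow>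
        (\<Sum>k\<in>d. norm (f (Sup k) - f (Inf k))) < e / (L + 1)"
    using f unfolding abs_cont_on_interval_def by metis
  have "(\<Sum>k\<in>d. norm (g (f (Sup k)) - g (f (Inf k)))) < e"
    if d: "d division_of t" "t \<subseteq> {a..b}" "(\<Sum>k\<in>d. Sup k - Inf k) < \<delta>" for d t
  proof -
    have "(\<Sum>k\<in>d. norm (g (f (Sup k)) - g (f (Inf k)))) \<le> (\<Sum>k\<in>d. L * norm (f (Sup k) - f (Inf k)))"
    proof (rule sum_mono)
      fix k assume "k \<in> d"
      with d obtain "Inf k \<in> {a..b}" "Sup k \<in> {a..b}"
        using division_of_real_intervalE by metis
      then show "norm (g (f (Sup k)) - g (f (Inf k))) \<le> L * norm (f (Sup k) - f (Inf k))"
        using lipschitz_onD[OF g, of "f (Sup k)" "f (Inf k)"] fS by (simp add: dist_norm image_subset_iff)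
    qed
    also have "\<dots> = L * (\<Sum>k\<in>d. norm (f (Sup k) - f (Inf k)))" by (simp add: sum_distrib_left)
    also have "\<dots> \<le> L * (e / (L + 1))"
      using \<delta>(2)[OF d] L by (intro mult_left_mono) auto
    also have "\<dots> < e" using L e by (simp add: field_simps)
    finally show ?thesis .
  qed
  then show "\<exists>\<delta>>0. \<forall>d t. d division_of t \<and> t \<subseteq> {a..b} \<and> (\<Sum>k\<in>d. Sup k - Inf k) < \<delta> \<longrightarrow>
        (\<Sum>k\<in>d. norm (g (f (Sup k)) - g (f (Inf k)))) < e"
    using \<delta>(1) by blast
qed

lemma abs_cont_on_interval_ident: "abs_cont_on_interval a b (\<lambda>t. t)"
  unfolding abs_cont_on_interval_def
proof (intro allI impI)
  fix e :: real assume e: "e > 0"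
  have "(\<Sum>k\<in>d. norm (Sup k - Inf k)) = (\<Sum>k\<in>d. Sup k - Inf k)"
    if "d division_of t" "t \<subseteq> {a..b}" for d t
  proof (rule sum.cong)
    fix k assume "k \<in> d"
    with that obtain "Inf k \<le> Sup k" using division_of_real_intervalE by metis
    then show "norm (Sup k - Inf k) = Sup k - Inf k" by simp
  qed simp
  then show "\<exists>\<delta>>0. \<forall>d t. d division_of t \<and> t \<subseteq> {a..b} \<and> (\<Sum>k\<in>d. Sup k - Inf k) < \<delta> \<longrightarrow>
        (\<Sum>k\<in>d. norm (Sup k - Inf k)) < e"
    using e by (intro exI[of _ e]) auto
qed

text \<open>A gauge confines the intervals tagged in \<^term>\<open>N\<close> to an open set of small measure, where
  absolute continuity makes their contribution negligible.\<close>
lemma abs_cont_growth_le: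
  fixes \<phi> :: "real \<Rightarrow> real"
  assumes ab: "a \<le> b" and ac: "abs_cont_on_interval a b \<phi>" and N: "negligible N" and c: "0 \<le> c"
    and straddle: "\<And>t. t \<in> {a..b} - N \<Longrightarrow> \<exists>d>0. \<forall>u\<in>{a..b}. \<forall>v\<in>{a..b}.
          u \<le> t \<and> t \<le> v \<and> v - u < d \<longrightarrow> \<phi> v - \<phi> u \<le> c * (v - u)"
  shows "\<phi> b - \<phi> a \<le> c * (b - a)"
proof (rule field_le_epsilon)
  fix \<epsilon> :: real assume \<epsilon>: "\<epsilon> > 0"
  obtain \<delta> where \<delta>: "\<delta> > 0" "\<And>d t. d division_of t \<Longrightarrow> t \<subseteq> {a..b} \<Longrightarrow> (\<Sum>k\<in>d. Sup k - Inf k) < \<delta> \<Longrightarrow>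
        (\<Sum>k\<in>d. norm (\<phi> (Sup k) - \<phi> (Inf k))) < \<epsilon>"
    using ac \<epsilon> unfolding abs_cont_on_interval_def by metis
  have Nn: "N \<in> null_sets lebesgue" using N by (simp add: negligible_iff_null_sets)
  then have Ns: "N \<in> sets lebesgue" by auto
  obtain T where T: "open T" "N \<subseteq> T" "emeasure lebesgue (T - N) < ennreal \<delta>"
    using sets_lebesgue_outer_open[OF Ns \<delta>(1)] by metis
  have Ts: "T \<in> sets lebesgue" using T(1) by auto
  have "emeasure lebesgue T < ennreal \<delta>"
    using emeasure_Diff_null_set[OF Nn Ts] T(3) by simp
  moreover from this have "T \<in> lmeasurable"
    using less_trans[OF _ ennreal_less_top] by (intro fmeasurableI Ts) simp
  ultimately have Tm: "T \<in> lmeasurable" "measure lebesgue T < \<delta>"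
    by (auto simp only: emeasure_eq_measure2 ennreal_less_iff measure_nonneg)
  have "\<exists>d. \<forall>t\<in>{a..b} - N. d t > 0 \<and> (\<forall>u\<in>{a..b}. \<forall>v\<in>{a..b}.
          u \<le> t \<and> t \<le> v \<and> v - u < d t \<longrightarrow> \<phi> v - \<phi> u \<le> c * (v - u))"
    using straddle by (intro bchoice) blast
  then obtain d where d: "\<And>t. t \<in> {a..b} - N \<Longrightarrow> d t > 0"
    and dD: "\<And>t u v. t \<in> {a..b} - N \<Longrightarrow> u \<in> {a..b} \<Longrightarrow> v \<in> {a..b} \<Longrightarrow>
          u \<le> t \<Longrightarrow> t \<le> v \<Longrightarrow> v - u < d t \<Longrightarrow> \<phi> v - \<phi> u \<le> c * (v - u)"
    by metis
  \<comment> \<open>Radius \<open>d t / 2\<close> puts both ends of an interval tagged at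
    \<open>t\<close> within \<open>d t / 2\<close> of \<open>t\<close>, so its length is below
    \<open>d t\<close>.\<close>
  define \<gamma> where "\<gamma> t = (if t \<in> N then T else if t \<in> {a..b} then ball t (d t / 2) else UNIV)" for t
  have "gauge \<gamma>"
    unfolding gauge_def \<gamma>_def using T d by auto
  then obtain p where p: "p tagged_division_of {a..b}" "\<gamma> fine p"
    by (rule fine_division_exists_real)
  note pD = tagged_division_ofD[OF p(1)]
  define q where "q = {x \<in> p. fst x \<in> N}"
  have "q \<subseteq> p" by (auto simp: q_def)
  have fin: "finite p" by (rule pD(1))
  have qp: "q tagged_partial_division_of {a..b}"
    using p(1) \<open>q \<subseteq> p\<close> tagged_partial_division_subset unfolding tagged_division_of_def by blast
  let ?Q = "\<Union>(snd ` q)"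
  have qdiv: "snd ` q division_of ?Q" by (rule partial_division_of_tagged_division[OF qp])
  have Qab: "?Q \<subseteq> {a..b}" using pD(3) \<open>q \<subseteq> p\<close> by fastforce
  have "?Q \<subseteq> T"
    using p(2) unfolding fine_def q_def by (fastforce simp: \<gamma>_def)
  \<comment> \<open>The total length equals the measure of the union, which lies in
    \<open>T\<close>; this is what makes absolute continuity applicable.\<close>
  have "(\<Sum>k\<in>snd ` q. Sup k - Inf k) = (\<Sum>k\<in>snd ` q. measure lebesgue k)"
  proof (rule sum.cong)
    have len: "measure lebesgue {u..v} = v - u" if "u \<le> v" for u v :: real
      using that by simp
    fix k assume "k \<in> snd ` q"
    then obtain "k = {Inf k..Sup k}" "Inf k \<le> Sup k"
      using division_of_real_intervalE[OF qdiv _ Qab] by metis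
    then show "Sup k - Inf k = measure lebesgue k"
      using len by metis
  qed simp
  also have "\<dots> = measure lebesgue ?Q" by (rule content_division[OF qdiv])
  also have "\<dots> \<le> measure lebesgue T"
    using \<open>?Q \<subseteq> T\<close> Tm(1) lmeasurable_division[OF qdiv] by (intro measure_mono_fmeasurable) auto
  also have "\<dots> < \<delta>" by (rule Tm(2))
  finally have "(\<Sum>k\<in>snd ` q. norm (\<phi> (Sup k) - \<phi> (Inf k))) < \<epsilon>"
    by (rule \<delta>(2)[OF qdiv Qab])
  moreover have "(\<Sum>(t, k)\<in>q. norm (\<phi> (Sup k) - \<phi> (Inf k))) = (\<Sum>k\<in>snd ` q. norm (\<phi> (Sup k) - \<phi> (Inf k)))"
  proof -
    \<comment> \<open>\<open>snd\<close> is injective on \<open>q\<close> only up to degenerate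
      intervals: one with two tags has empty interior, so it is a point and contributes 0.\<close>
    have "norm (\<phi> (Sup k) - \<phi> (Inf k)) = 0"
      if tk: "(t, k) \<in> p" "(t', k) \<in> p" "t \<noteq> t'" for t t' k
    proof -
      obtain u v where uv: "k = cbox u v" using pD(4)[OF tk(1)] by blast
      have "t \<in> k" using pD(2)[OF tk(1)] .
      have "interior k = {}" using pD(5)[OF tk(1,2)] tk(3) by simp
      then have "u = v" using \<open>t \<in> k\<close> by (auto simp: uv)
      then show ?thesis by (simp add: uv)
    qed
    then have "(\<Sum>k\<in>snd ` q. norm (\<phi> (Sup k) - \<phi> (Inf k)))
        = sum ((\<lambda>k. norm (\<phi> (Sup k) - \<phi> (Inf k))) \<circ> snd) q"
      using finite_subset[OF \<open>q \<subseteq> p\<close> fin] \<open>q \<subseteq> p\<close>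
      by (intro sum.reindex_nontrivial) (auto, blast)
    then show ?thesis by (simp add: comp_def case_prod_unfold)
  qed
  moreover have "(\<Sum>(t, k)\<in>q. \<phi> (Sup k) - \<phi> (Inf k)) \<le> (\<Sum>(t, k)\<in>q. norm (\<phi> (Sup k) - \<phi> (Inf k)))"
    by (intro sum_mono) auto
  ultimately have q_le: "(\<Sum>(t, k)\<in>q. \<phi> (Sup k) - \<phi> (Inf k)) \<le> \<epsilon>" by linarith
  have kE: "k = {Inf k..Sup k} \<and> Inf k \<le> t \<and> t \<le> Sup k \<and> a \<le> Inf k \<and> Sup k \<le> b" if tk: "(t, k) \<in> p" for t k
  proof -
    obtain u v where uv: "k = cbox u v" using pD(4)[OF tk] by blast
    moreover have "t \<in> k" "k \<subseteq> {a..b}" using pD(2,3)[OF tk] by auto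
    ultimately show ?thesis by auto
  qed
  have "(\<Sum>(t, k)\<in>p - q. \<phi> (Sup k) - \<phi> (Inf k)) \<le> (\<Sum>(t, k)\<in>p - q. c * (Sup k - Inf k))"
  proof (rule sum_mono, clarify)
    fix t k assume tk: "(t, k) \<in> p" "(t, k) \<notin> q"
    have k: "k = {Inf k..Sup k}" "Inf k \<le> t" "t \<le> Sup k" "a \<le> Inf k" "Sup k \<le> b"
      using kE[OF tk(1)] by auto
    have t: "t \<in> {a..b} - N" using k tk by (auto simp: q_def)
    have "k \<subseteq> ball t (d t / 2)"
      using fineD[OF p(2) tk(1)] t by (simp add: \<gamma>_def)
    moreover have "Inf k \<in> k" "Sup k \<in> k" using k by (metis atLeastAtMost_iff order_refl order_trans)+
    ultimately have "Inf k \<in> ball t (d t / 2)" "Sup k \<in> ball t (d t / 2)" by auto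
    then have "\<bar>t - Inf k\<bar> < d t / 2" "\<bar>t - Sup k\<bar> < d t / 2" by (auto simp: dist_real_def)
    then have "Sup k - Inf k < d t" by linarith
    then show "\<phi> (Sup k) - \<phi> (Inf k) \<le> c * (Sup k - Inf k)"
      using k by (intro dD[OF t]) auto
  qed
  \<comment> \<open>The terms restored here are nonnegative because
    \<open>0 \<le> c\<close>.\<close>
  also have "\<dots> \<le> (\<Sum>(t, k)\<in>p. c * (Sup k - Inf k))"
    using fin kE c by (intro sum_mono2) (fastforce intro!: mult_nonneg_nonneg)+
  also have "\<dots> = c * (\<Sum>(t, k)\<in>p. Sup k - Inf k)"
    by (simp add: sum_distrib_left case_prod_unfold)
  also have "(\<Sum>(t, k)\<in>p. Sup k - Inf k) = b - a"
    using additive_tagged_division_1[OF ab p(1), of "\<lambda>x. x"] by simp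
  finally have "(\<Sum>(t, k)\<in>p - q. \<phi> (Sup k) - \<phi> (Inf k)) \<le> c * (b - a)" .
  moreover have "\<phi> b - \<phi> a = (\<Sum>(t, k)\<in>p - q. \<phi> (Sup k) - \<phi> (Inf k)) + (\<Sum>(t, k)\<in>q. \<phi> (Sup k) - \<phi> (Inf k))"
    using sum.subset_diff[OF \<open>q \<subseteq> p\<close> fin] additive_tagged_division_1[OF ab p(1), of \<phi>] by metis
  ultimately show "\<phi> b - \<phi> a \<le> c * (b - a) + \<epsilon>" using q_le by linarith
qed

section \<open>Increments and the Clarke gradient\<close>

text \<open>On a small increment along \<open>g\<close> itself, \<open>B\<close> grows at rate
  nearly \<open>norm g\<close>, which the Lipschitz constant caps.\<close>

lemma norm_gradient_le_lipschitz:
  fixes B :: "'a::euclidean_space \<Rightarrow> real"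
  assumes B: "L-lipschitz_on S B" and S: "open S" "z \<in> S" and g: "GDERIV B z :> g"
  shows "norm g \<le> L"
proof (rule field_le_epsilon)
  fix e :: real assume e: "e > 0"
  show "norm g \<le> L + e"
  proof (cases "g = 0")
    case True
    then show ?thesis using e lipschitz_on_nonneg[OF B] by simp
  next
    case False
    obtain d where d: "d > 0" "\<And>w. norm (w - z) < d \<Longrightarrow> \<bar>B w - B z - (w - z) \<bullet> g\<bar> \<le> e * norm (w - z)"
      using g e unfolding gderiv_def has_derivative_at_alt by fastforce
    obtain d' where d': "d' > 0" "ball z d' \<subseteq> S" using S by (meson openE)
    define t where "t = min d d' / (2 * norm g)"
    have t: "t > 0" using False d d' by (simp add: t_def)
    have "norm (t *\<^sub>R g) = t * norm g" using t by simp
    then have nt: "norm (t *\<^sub>R g) = min d d' / 2" using False by (simp add: t_def)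
    then have small: "norm (t *\<^sub>R g) < d" "norm (t *\<^sub>R g) < d'" using d(1) d'(1) by linarith+
    have "\<bar>B (z + t *\<^sub>R g) - B z - (t *\<^sub>R g) \<bullet> g\<bar> \<le> e * norm (t *\<^sub>R g)"
      using d(2)[of "z + t *\<^sub>R g"] small(1) by (simp only: add_diff_cancel_left')
    moreover have "z + t *\<^sub>R g \<in> S" using d'(2) small(2) by (auto simp: dist_norm)
    then have "\<bar>B (z + t *\<^sub>R g) - B z\<bar> \<le> L * norm (t *\<^sub>R g)"
      using lipschitz_onD[OF B, of "z + t *\<^sub>R g" z] S(2) by (simp add: dist_norm)
    ultimately have "(t *\<^sub>R g) \<bullet> g \<le> (L + e) * norm (t *\<^sub>R g)"
      by (simp only: distrib_right)
    moreover have "(t *\<^sub>R g) \<bullet> g = norm g * norm (t *\<^sub>R g)"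
      using t by (simp add: dot_square_norm power2_eq_square)
    ultimately have "norm g * norm (t *\<^sub>R g) \<le> (L + e) * norm (t *\<^sub>R g)"
      by (simp only:)
    moreover have "0 < norm (t *\<^sub>R g)" using t False by simp
    ultimately show ?thesis by (simp only: mult_le_cancel_right_pos)
  qed
qed

text \<open>Upper semicontinuity of the Clarke gradient, tested in direction \<open>v\<close>:
  gradients violating the bound at points tending to \<open>p\<close> are bounded by
  \<open>L\<close>, so a subsequence converges to an element of \<open>clarke_gradient N B p\<close>
  whose product with \<open>v\<close> is at least \<open>c\<close>.\<close>

lemma gradient_bound_near:
  fixes B :: "'a::euclidean_space \<Rightarrow> real"
  assumes B: "L-lipschitz_on S B" and S: "open S" "p \<in> S"
    and clarke: "\<And>\<zeta>. \<zeta> \<in> clarke_gradient N B p \<Longrightarrow> \<zeta> \<bullet> v \<le> 0" and c: "c > 0"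
  shows "\<exists>r>0. \<forall>z g. z \<in> ball p r \<and> z \<notin> N \<and> (GDERIV B z :> g) \<longrightarrow> g \<bullet> v < c"
proof (rule ccontr)
  assume "\<not> ?thesis"
  then have neg: "\<And>r. r > 0 \<Longrightarrow> \<exists>z g. z \<in> ball p r \<and> z \<notin> N \<and> (GDERIV B z :> g) \<and> c \<le> g \<bullet> v"
    by (meson not_less)
  obtain r0 where r0: "r0 > 0" "ball p r0 \<subseteq> S" using S by (meson openE)
  have "\<forall>n. \<exists>z g. z \<in> ball p (min r0 (inverse (real (Suc n)))) \<and> z \<notin> N \<and> (GDERIV B z :> g) \<and> c \<le> g \<bullet> v"
    using r0 by (intro allI neg) simp
  then obtain X g where X: "\<And>n. X n \<in> ball p (min r0 (inverse (real (Suc n))))" "\<And>n. X n \<notin> N"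
      "\<And>n. GDERIV B (X n) :> g n" "\<And>n. c \<le> g n \<bullet> v"
    by metis
  have "norm (g n) \<le> L" for n
    using X(1)[of n] r0 by (intro norm_gradient_le_lipschitz[OF B S(1) _ X(3)[of n]]) auto
  then have "bounded (range g)" unfolding bounded_iff by blast
  then obtain l s where s: "strict_mono s" "(g \<circ> s) \<longlonglongrightarrow> l"
    using bounded_imp_convergent_subsequence by blast
  have "X \<longlonglongrightarrow> p"
  proof (rule metric_LIMSEQ_I)
    fix e :: real assume "e > 0"
    then obtain n0 where n0: "inverse (real (Suc n0)) < e" using reals_Archimedean by blast
    have "dist (X n) p < e" if "n \<ge> n0" for n
    proof -
      have "dist (X n) p < inverse (real (Suc n))" using X(1)[of n] by (simp add: dist_commute)
      also have "\<dots> \<le> inverse (real (Suc n0))" using that by (simp add: field_simps)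
      finally show ?thesis using n0 by simp
    qed
    then show "\<exists>no. \<forall>n\<ge>no. dist (X n) p < e" by blast
  qed
  then have Xs: "(X \<circ> s) \<longlonglongrightarrow> p" using s(1) by (rule LIMSEQ_subseq_LIMSEQ)
  have "l \<in> clarke_gradient N B p"
    unfolding clarke_gradient_def
  proof (rule hull_inc, unfold mem_Collect_eq, intro exI conjI)
    show "(X \<circ> s) \<longlonglongrightarrow> p" "(g \<circ> s) \<longlonglongrightarrow> l" by (fact Xs s(2))+
  qed (use X(2,3) in simp)
  then have "l \<bullet> v \<le> 0" by (rule clarke)
  moreover have "c \<le> l \<bullet> v"
  proof (rule LIMSEQ_le_const)
    show "(\<lambda>n. (g \<circ> s) n \<bullet> v) \<longlonglongrightarrow> l \<bullet> v" by (intro tendsto_intros s(2))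
  qed (use X(4) in auto)
  ultimately show False using c by simp
qed

text \<open>By Fubini, almost every line parallel to \<^term>\<open>v\<close> meets the exceptional set in a null set;
  the remaining lines follow by continuity.\<close>
lemma segment_increment_le:
  fixes F :: "'a::euclidean_space \<Rightarrow> real"
  assumes F: "L-lipschitz_on UNIV F" and N: "negligible N" and W: "open W" "convex W"
    and grad: "\<And>z g. z \<in> W \<Longrightarrow> z \<notin> N \<Longrightarrow> GDERIV F z :> g \<Longrightarrow> g \<bullet> v < c"
    and c: "0 \<le> c" and h: "0 \<le> h" and y: "y \<in> W" "y + h *\<^sub>R v \<in> W"
  shows "F (y + h *\<^sub>R v) - F y \<le> c * h"
proof (rule ccontr)
  assume "\<not> ?thesis"
  then have gt: "c * h < F (y + h *\<^sub>R v) - F y" by simp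
  have cont: "continuous_on UNIV F" using F by (rule lipschitz_on_continuous_on)
  have "N \<in> null_sets lebesgue" using N by (simp add: negligible_iff_null_sets)
  then have "AE z in lborel. z \<notin> N"
    by (metis AE_completion_iff AE_not_in completion.AE_iff_null_sets)
  with Rademacher[OF F] have "AE z in lborel. z \<notin> N \<and> (\<exists>g. GDERIV F z :> g)"
    by eventually_elim auto
  then obtain Z where Z: "Z \<in> null_sets lborel" "\<And>z. z \<notin> Z \<Longrightarrow> z \<notin> N \<and> (\<exists>g. GDERIV F z :> g)"
    by (rule AE_E3) auto
  have "AE y in lborel. AE s::real in lborel. y + s *\<^sub>R v \<notin> Z"
    using AE_line_iff_null_sets[of Z v] Z(1) by (simp add: null_sets_def)
  then obtain M where M: "M \<in> null_sets lborel" "\<And>y. y \<notin> M \<Longrightarrow> AE s::real in lborel. y + s *\<^sub>R v \<notin> Z"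
    by (rule AE_E3) auto
  \<comment> \<open>A violation persists for all starting points in this open set. Being nonempty,
    it is not null, so it contains the start of a line that meets \<open>Z\<close> only in a null
    set.\<close>
  define V where "V = {y. c * h < F (y + h *\<^sub>R v) - F y} \<inter> (W \<inter> (\<lambda>y. y + h *\<^sub>R v) -` W)"
  have "open V"
    unfolding V_def
    by (intro open_Int W(1) open_Collect_less continuous_open_vimage continuous_intros
        continuous_on_compose2[OF cont]) auto
  moreover have "y \<in> V" using gt y by (simp add: V_def)
  ultimately have "\<not> negligible V" using open_not_negligible by blast
  moreover have "negligible M" using M(1) by (simp add: negligible_iff_null_sets null_sets_completionI)
  ultimately obtain w where w: "w \<in> V" "w \<notin> M" using negligible_subset by blast
  have "AE s::real in lborel. w + s *\<^sub>R v \<notin> Z" using w(2) M(2) by blast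
  then obtain Q where Q: "Q \<in> null_sets lborel" "\<And>s::real. s \<notin> Q \<Longrightarrow> w + s *\<^sub>R v \<notin> Z"
    by (rule AE_E3) auto
  have "F (w + h *\<^sub>R v) - F (w + 0 *\<^sub>R v) \<le> c * (h - 0)"
  proof (rule abs_cont_growth_le[OF h _ _ c])
    show "negligible Q" using Q(1) by (simp add: negligible_iff_null_sets null_sets_completionI)
    show "abs_cont_on_interval 0 h (\<lambda>s. F (w + s *\<^sub>R v))"
      by (rule abs_cont_on_interval_lipschitz_compose[OF abs_cont_on_interval_ident lipschitz_on_line[OF F]]) auto
  next
    fix t assume t: "t \<in> {0..h} - Q"
    define z where "z = w + t *\<^sub>R v"
    have "z \<notin> Z" using t Q(2) by (auto simp: z_def)
    then obtain g where g: "z \<notin> N" "GDERIV F z :> g" using Z(2) by blast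
    have "z \<in> W"
    proof -
      have w2: "w \<in> W" "w + h *\<^sub>R v \<in> W" using w(1) by (auto simp: V_def)
      show ?thesis
      proof (cases "h = 0")
        case True
        then show ?thesis using w2 t by (simp add: z_def)
      next
        case False
        then have "h > 0" using h by simp
        have "(1 - t / h) *\<^sub>R w + (t / h) *\<^sub>R (w + h *\<^sub>R v) \<in> W"
          using t \<open>h > 0\<close> by (intro convexD[OF W(2) w2]) auto
        moreover have "(1 - t / h) *\<^sub>R w + (t / h) *\<^sub>R (w + h *\<^sub>R v) = z"
          using \<open>h > 0\<close> by (simp add: z_def algebra_simps)
        ultimately show ?thesis by simp
      qed
    qed
    then have gv: "g \<bullet> v < c" using g by (intro grad)
    have "((\<lambda>s. F (w + s *\<^sub>R v)) has_derivative (\<lambda>s. (s *\<^sub>R v) \<bullet> g)) (at t)"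
      by (rule has_derivative_compose[of "\<lambda>s. w + s *\<^sub>R v" "\<lambda>s. s *\<^sub>R v" t UNIV F "\<lambda>h. h \<bullet> g"])
         (use g(2) in \<open>auto simp: gderiv_def z_def intro!: derivative_eq_intros\<close>)
    \<comment> \<open>The strict bound on the gradient leaves room for this tolerance; the errors on
      both sides of \<open>t\<close> then add up to exactly \<open>c * (s2 - s1)\<close>.\<close>
    moreover define e where "e = c - g \<bullet> v"
    moreover have "e > 0" using gv by (simp add: e_def)
    ultimately obtain d where d: "d > 0" "\<And>s. norm (s - t) < d \<Longrightarrow>
        norm (F (w + s *\<^sub>R v) - F (w + t *\<^sub>R v) - ((s - t) *\<^sub>R v) \<bullet> g) \<le> e * norm (s - t)"
      unfolding has_derivative_at_alt by blast
    have "F (w + s2 *\<^sub>R v) - F (w + s1 *\<^sub>R v) \<le> c * (s2 - s1)"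
      if s: "s1 \<le> t" "t \<le> s2" "s2 - s1 < d" for s1 s2
    proof -
      have "\<bar>F (w + s2 *\<^sub>R v) - F (w + t *\<^sub>R v) - (s2 - t) * (g \<bullet> v)\<bar> \<le> e * (s2 - t)"
        using d(2)[of s2] s by (simp add: inner_commute)
      moreover have "\<bar>F (w + s1 *\<^sub>R v) - F (w + t *\<^sub>R v) - (s1 - t) * (g \<bullet> v)\<bar> \<le> e * (t - s1)"
        using d(2)[of s1] s by (simp add: inner_commute)
      ultimately have "F (w + s2 *\<^sub>R v) - F (w + s1 *\<^sub>R v)
          \<le> e * (s2 - t) + e * (t - s1) + (s2 - t) * (g \<bullet> v) - (s1 - t) * (g \<bullet> v)"
        by linarith
      also have "\<dots> = c * (s2 - s1)" by (simp add: e_def algebra_simps)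
      finally show ?thesis .
    qed
    then show "\<exists>d>0. \<forall>s1\<in>{0..h}. \<forall>s2\<in>{0..h}. s1 \<le> t \<and> t \<le> s2 \<and> s2 - s1 < d \<longrightarrow>
        F (w + s2 *\<^sub>R v) - F (w + s1 *\<^sub>R v) \<le> c * (s2 - s1)"
      using d(1) by blast
  qed
  moreover have "c * h < F (w + h *\<^sub>R v) - F w" using w(1) by (simp add: V_def)
  ultimately show False by simp
qed

text \<open>Being uniform in the base point \<open>y\<close>, this bounds Clarke's directional
  derivative of \<open>B\<close> at \<open>p\<close>, not just the ordinary one. That allows
  increments which start behind \<open>p\<close>.\<close>

lemma clarke_directional_increment_le:
  fixes B :: "'a::euclidean_space \<Rightarrow> real"
  assumes B: "L-lipschitz_on S B" and S: "open S" "p \<in> S" and N: "negligible N"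
    and clarke: "\<And>\<zeta>. \<zeta> \<in> clarke_gradient N B p \<Longrightarrow> \<zeta> \<bullet> v \<le> 0" and c: "c > 0"
  shows "\<exists>r>0. ball p r \<subseteq> S \<and> (\<forall>y h. y \<in> ball p r \<and> y + h *\<^sub>R v \<in> ball p r \<and> 0 \<le> h \<longrightarrow>
           B (y + h *\<^sub>R v) - B y \<le> c * h)"
proof -
  obtain \<rho> where \<rho>: "\<rho> > 0" "cball p \<rho> \<subseteq> S" using S by (meson open_contains_cball)
  \<comment> \<open>Projecting to a closed ball, which does not increase distances, extends
    \<open>B\<close> to a globally Lipschitz function, as Rademacher's theorem requires.\<close>
  define F where "F = (\<lambda>z. B (closest_point (cball p \<rho>) z))"
  have cp: "closest_point (cball p \<rho>) z \<in> cball p \<rho>" for z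
    using \<rho> by (intro closest_point_in_set) auto
  have F: "L-lipschitz_on UNIV F"
  proof (rule lipschitz_onI)
    fix y z :: 'a
    have "dist (F y) (F z) \<le> L * dist (closest_point (cball p \<rho>) y) (closest_point (cball p \<rho>) z)"
      unfolding F_def using cp \<rho>(2) by (intro lipschitz_onD[OF B]) auto
    also have "\<dots> \<le> L * dist y z"
      using \<rho>(1) lipschitz_on_nonneg[OF B] by (intro mult_left_mono closest_point_lipschitz) auto
    finally show "dist (F y) (F z) \<le> L * dist y z" .
  qed (rule lipschitz_on_nonneg[OF B])
  have FB: "F z = B z" if "z \<in> cball p \<rho>" for z
    using that by (simp add: F_def closest_point_self)
  obtain r0 where r0: "r0 > 0" "\<And>z g. z \<in> ball p r0 \<Longrightarrow> z \<notin> N \<Longrightarrow> GDERIV B z :> g \<Longrightarrow> g \<bullet> v < c"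
    using gradient_bound_near[OF B S clarke c] by blast
  define r where "r = min r0 \<rho>"
  have r: "r > 0" "ball p r \<subseteq> cball p \<rho>" "ball p r \<subseteq> ball p r0" using r0 \<rho> by (auto simp: r_def)
  have "B (y + h *\<^sub>R v) - B y \<le> c * h" if y: "y \<in> ball p r" "y + h *\<^sub>R v \<in> ball p r" "0 \<le> h" for y h
  proof -
    have "F (y + h *\<^sub>R v) - F y \<le> c * h"
    proof (rule segment_increment_le[OF F N open_ball convex_ball _ _ y(3,1,2)])
      fix z g assume z: "z \<in> ball p r" "z \<notin> N" "GDERIV F z :> g"
      have "(B has_derivative (\<lambda>h. h \<bullet> g)) (at z)"
      proof (rule has_derivative_transform_within_open[OF _ open_ball z(1)])
        show "(F has_derivative (\<lambda>h. h \<bullet> g)) (at z)" using z(3) by (simp add: gderiv_def)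
      qed (use r FB in blast)
      then show "g \<bullet> v < c" using z r by (intro r0(2)[of z]) (auto simp: gderiv_def)
    qed (use c in simp)
    then show ?thesis using y r FB by (metis subsetD)
  qed
  then show ?thesis using r \<rho>(2) by blast
qed

text \<open>Both ends of the increment are moved to the tangent line at \<open>t\<close>, where the
  directional estimate applies; the Lipschitz condition pays for the move. The result has the
  straddling form that \<open>abs_cont_growth_le\<close> asks for.\<close>

lemma clarke_curve_increment_le:
  fixes B :: "'a::euclidean_space \<Rightarrow> real" and x :: "real \<Rightarrow> 'a"
  assumes B: "L-lipschitz_on S B" and S: "open S" "x t \<in> S" and N: "negligible N"
    and clarke: "\<And>\<zeta>. \<zeta> \<in> clarke_gradient N B (x t) \<Longrightarrow> \<zeta> \<bullet> v \<le> 0"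
    and x: "(x has_vector_derivative v) (at t)" and c: "c > 0"
  shows "\<exists>d>0. \<forall>s1 s2. s1 \<le> t \<and> t \<le> s2 \<and> s2 - s1 < d \<longrightarrow> B (x s2) - B (x s1) \<le> c * (s2 - s1)"
proof -
  have L: "0 \<le> L" using B by (rule lipschitz_on_nonneg)
  obtain r where r: "r > 0" "ball (x t) r \<subseteq> S" "\<And>y h. y \<in> ball (x t) r \<Longrightarrow> y + h *\<^sub>R v \<in> ball (x t) r \<Longrightarrow> 0 \<le> h \<Longrightarrow>
           B (y + h *\<^sub>R v) - B y \<le> c / 2 * h"
    using clarke_directional_increment_le[where c = "c / 2", OF B S N clarke] c by auto
  \<comment> \<open>Half of \<open>c\<close> is spent along the tangent, half on the deviation of
    the curve from it.\<close>
  define e where "e = c / (2 * (L + 1))"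
  have e: "e > 0" "L * e \<le> c / 2" using L c by (auto simp: e_def field_simps)
  obtain d1 where d1: "d1 > 0" "\<And>s. norm (s - t) < d1 \<Longrightarrow> norm (x s - x t - (s - t) *\<^sub>R v) \<le> e * norm (s - t)"
    using x e(1) unfolding has_vector_derivative_def has_derivative_at_alt by blast
  \<comment> \<open>Within this time, tangent displacement and deviation together stay below
    \<open>r\<close>.\<close>
  define d where "d = min d1 (r / (norm v + e))"
  have ve: "norm v + e > 0" using e(1) by (simp add: add_nonneg_pos)
  have d: "d > 0" using d1 r ve by (simp add: d_def)
  have near: "x t + (s - t) *\<^sub>R v \<in> ball (x t) r \<and> x s \<in> ball (x t) r \<and>
      norm (x s - (x t + (s - t) *\<^sub>R v)) \<le> e * \<bar>s - t\<bar>" if s: "\<bar>s - t\<bar> < d" for s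
  proof -
    have n1: "norm (x s - x t - (s - t) *\<^sub>R v) \<le> e * \<bar>s - t\<bar>"
      using d1(2)[of s] s by (simp add: d_def)
    have "\<bar>s - t\<bar> * (norm v + e) < r"
      using s ve by (simp add: d_def pos_less_divide_eq)
    then have small: "\<bar>s - t\<bar> * norm v + e * \<bar>s - t\<bar> < r" by (simp add: algebra_simps)
    have "norm (x s - x t) \<le> norm ((s - t) *\<^sub>R v) + norm (x s - x t - (s - t) *\<^sub>R v)"
      by (rule norm_triangle_sub)
    also have "\<dots> < r" using n1 small by simp
    finally have "x s \<in> ball (x t) r" by (simp add: dist_norm norm_minus_commute)
    moreover have "norm ((s - t) *\<^sub>R v) < r"
    proof -
      have "0 \<le> e * \<bar>s - t\<bar>" using e by simp
      then show ?thesis using small by simp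
    qed
    then have "x t + (s - t) *\<^sub>R v \<in> ball (x t) r" by (simp add: dist_norm)
    ultimately show ?thesis using n1 by (simp add: diff_diff_eq)
  qed
  have "B (x s2) - B (x s1) \<le> c * (s2 - s1)" if s: "s1 \<le> t" "t \<le> s2" "s2 - s1 < d" for s1 s2
  proof -
    define y1 y2 where "y1 = x t + (s1 - t) *\<^sub>R v" and "y2 = x t + (s2 - t) *\<^sub>R v"
    have n1: "y1 \<in> ball (x t) r" "x s1 \<in> ball (x t) r" "norm (x s1 - y1) \<le> e * (t - s1)"
      using near[of s1] s by (auto simp: y1_def)
    have n2: "y2 \<in> ball (x t) r" "x s2 \<in> ball (x t) r" "norm (x s2 - y2) \<le> e * (s2 - t)"
      using near[of s2] s by (auto simp: y2_def)
    have inS: "y1 \<in> S" "x s1 \<in> S" "y2 \<in> S" "x s2 \<in> S" using n1 n2 r(2) by blast+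
    have "y2 = y1 + (s2 - s1) *\<^sub>R v" by (simp add: y1_def y2_def algebra_simps)
    then have "B y2 - B y1 \<le> c / 2 * (s2 - s1)" using r(3)[of y1 "s2 - s1"] n1 n2 s by simp
    moreover have "\<bar>B (x s1) - B y1\<bar> \<le> L * norm (x s1 - y1)"
      using lipschitz_onD[OF B, of "x s1" y1] inS by (simp add: dist_norm)
    moreover have "\<bar>B (x s2) - B y2\<bar> \<le> L * norm (x s2 - y2)"
      using lipschitz_onD[OF B, of "x s2" y2] inS by (simp add: dist_norm)
    moreover have "L * norm (x s1 - y1) \<le> L * (e * (t - s1))" "L * norm (x s2 - y2) \<le> L * (e * (s2 - t))"
      using n1(3) n2(3) L by (auto intro: mult_left_mono)
    ultimately have "B (x s2) - B (x s1) \<le> c / 2 * (s2 - s1) + L * (e * (t - s1)) + L * (e * (s2 - t))"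
      by linarith
    also have "\<dots> = c / 2 * (s2 - s1) + L * e * (s2 - s1)" by (simp add: algebra_simps)
    also have "\<dots> \<le> c / 2 * (s2 - s1) + c / 2 * (s2 - s1)"
      using e(2) s by (intro add_left_mono mult_right_mono) auto
    finally show ?thesis by (simp add: field_simps)
  qed
  then show ?thesis using d by blast
qed

section \<open>Invariance under flows and jumps\<close>

text \<open>The point \<open>x (t + h)\<close> of \<open>C\<close> is at distance o(h) from
  \<open>x t + h *\<^sub>R v\<close>, so the quotients even converge to 0.\<close>

lemma contingent_cone_if_curve:
  fixes x :: "real \<Rightarrow> 'a::euclidean_space"
  assumes x: "(x has_vector_derivative v) (at t)" and b: "t < b" and C: "\<And>s. t < s \<Longrightarrow> s < b \<Longrightarrow> x s \<in> C"
  shows "v \<in> contingent_cone C (x t)"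
proof -
  have "x ((t + b) / 2) \<in> C" using b by (intro C) auto
  then have "C \<noteq> {}" by auto
  have "((\<lambda>h. infdist (x t + h *\<^sub>R v) C / h) \<longlongrightarrow> 0) (at_right 0)"
  proof (rule tendstoI)
    fix e :: real assume e: "e > 0"
    then have "e / 2 > 0" by simp
    then obtain d where d: "d > 0" "\<And>s. norm (s - t) < d \<Longrightarrow> norm (x s - x t - (s - t) *\<^sub>R v) \<le> e / 2 * norm (s - t)"
      using x unfolding has_vector_derivative_def has_derivative_at_alt by blast
    have "dist (infdist (x t + h *\<^sub>R v) C / h) 0 < e" if h: "0 < h" "h < min d (b - t)" for h
    proof -
      have "infdist (x t + h *\<^sub>R v) C \<le> dist (x t + h *\<^sub>R v) (x (t + h))"
        using h by (intro infdist_le C) auto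
      also have "\<dots> = norm (x (t + h) - x t - h *\<^sub>R v)"
        by (simp add: dist_norm norm_minus_commute diff_diff_eq)
      also have "\<dots> \<le> e / 2 * h" using d(2)[of "t + h"] h by simp
      also have "\<dots> < e * h" using e h by simp
      finally have "infdist (x t + h *\<^sub>R v) C / h < e" using h by (simp add: pos_divide_less_eq)
      moreover have "0 \<le> infdist (x t + h *\<^sub>R v) C / h" using h infdist_nonneg by (intro divide_nonneg_pos) auto
      ultimately show ?thesis by (simp add: dist_real_def)
    qed
    then show "\<forall>\<^sub>F h in at_right 0. dist (infdist (x t + h *\<^sub>R v) C / h) 0 < e"
      using d(1) b unfolding eventually_at_right_field by (intro exI[of _ "min d (b - t)"]) auto
  qed
  then have "((\<lambda>h. ereal (infdist (x t + h *\<^sub>R v) C / h)) \<longlongrightarrow> 0) (at_right 0)"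
    by (simp add: zero_ereal_def)
  then have "Liminf (at_right 0) (\<lambda>h. ereal (infdist (x t + h *\<^sub>R v) C / h)) = 0"
    by (intro lim_imp_Liminf) auto
  then show ?thesis using \<open>C \<noteq> {}\<close> by (simp add: contingent_cone_def)
qed

lemma abs_cont_on_interval_subset:
  assumes "abs_cont_on_interval a b f" "{c..d} \<subseteq> {a..b}"
  shows "abs_cont_on_interval c d f"
  using assms unfolding abs_cont_on_interval_def by (meson order_trans)

lemma flow_stays_in_sublevel:
  fixes x :: "real \<Rightarrow> 'a::euclidean_space" and B :: "'a \<Rightarrow> real"
  assumes K: "K = {z \<in> C \<union> D. B z \<le> 0}" "closed K" and B: "locally_lipschitz B" and N: "negligible N"
    and U: "open U" "frontier K \<subseteq> U"
    and dec: "\<And>z \<eta> \<zeta>. z \<in> (U - K) \<inter> C \<Longrightarrow> \<eta> \<in> F z \<inter> contingent_cone C z \<Longrightarrow>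
                \<zeta> \<in> clarke_gradient N B z \<Longrightarrow> \<zeta> \<bullet> \<eta> \<le> 0"
    and ac: "abs_cont_on_interval a b x" and xa: "x a \<in> K"
    and xC: "\<And>t. t \<in> {a<..<b} \<Longrightarrow> x t \<in> C"
    and ode: "AE t in lebesgue. t \<in> {a<..<b} \<longrightarrow> (\<exists>v \<in> F (x t). (x has_vector_derivative v) (at t))"
    and t: "t \<in> {a..b}"
  shows "x t \<in> K"
proof -
  have cont: "continuous_on {a..b} x" using ac by (rule abs_cont_on_interval_imp_continuous_on)
  \<comment> \<open>The endpoint \<open>b\<close> is left aside because the curve is known to lie in
    \<open>C\<close> only on the open interval.\<close>
  have before: "x t1 \<in> K" if t1: "a \<le> t1" "t1 < b" for t1
  proof (rule ccontr)
    assume nK: "x t1 \<notin> K"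
    define S where "S = {a..t1} \<inter> x -` K"
    have "closed S"
      unfolding S_def using t1 by (intro continuous_closed_preimage continuous_on_subset[OF cont] K(2)) auto
    moreover have "a \<in> S" using xa t1 by (simp add: S_def)
    moreover have bdd: "bdd_above S" unfolding S_def by (rule bdd_above_mono[of "{a..t1}"]) auto
    ultimately have "Sup S \<in> S" by (intro closed_contains_Sup) auto
    define t0 where "t0 = Sup S"
    have t0: "a \<le> t0" "t0 \<le> t1" "x t0 \<in> K" using \<open>Sup S \<in> S\<close> by (auto simp: S_def t0_def)
    have "t0 \<noteq> t1" using t0(3) nK by auto
    then have t01: "t0 < t1" using t0(2) by simp
    have after: "x s \<notin> K" if "t0 < s" "s \<le> t1" for s
    proof
      assume "x s \<in> K"
      then have "s \<in> S" using that t0 by (simp add: S_def)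
      then have "s \<le> t0" unfolding t0_def by (rule cSup_upper[OF _ bdd])
      then show False using that by simp
    qed
    have near: "\<exists>t2. t0 < t2 \<and> t2 \<le> t1 \<and> (\<forall>s\<in>{t0..t2}. dist (x s) (x t0) < e)" if "e > 0" for e
    proof -
      have "t0 \<in> {a..b}" using t0 t1 by simp
      then obtain d where d: "d > 0" "\<And>s. s \<in> {a..b} \<Longrightarrow> dist s t0 < d \<Longrightarrow> dist (x s) (x t0) < e"
        using cont \<open>e > 0\<close> unfolding continuous_on_iff by metis
      show ?thesis
        using d t01 t1 t0 by (intro exI[of _ "min t1 (t0 + d / 2)"]) (auto simp: dist_real_def)
    qed
    have "x t0 \<in> closure (- K)"
      unfolding closure_approachable
    proof (intro allI impI)
      fix e :: real assume "e > 0"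
      from near[OF this] obtain t2 where "t0 < t2" "t2 \<le> t1" "dist (x t2) (x t0) < e" by force
      then show "\<exists>y\<in>- K. dist y (x t0) < e" using after by blast
    qed
    then have "x t0 \<in> frontier K" using t0(3) closure_subset by (auto simp: frontier_closures)
    then have "x t0 \<in> U" using U(2) by blast
    then obtain e where e: "e > 0" "ball (x t0) e \<subseteq> U" using U(1) by (meson openE)
    obtain r L where r: "r > 0" "L-lipschitz_on (ball (x t0) r) B"
      using B unfolding locally_lipschitz_def by blast
    obtain t2 where t2: "t0 < t2" "t2 \<le> t1" "\<And>s. s \<in> {t0..t2} \<Longrightarrow> dist (x s) (x t0) < min e r"
      using near[of "min e r"] e(1) r(1) by auto
    have xr: "x s \<in> ball (x t0) r" and xU: "x s \<in> U" if "s \<in> {t0..t2}" for s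
      using t2(3)[OF that] e(2) by (auto simp: dist_commute)
    \<comment> \<open>Leaving \<open>K\<close> means \<open>B > 0\<close> only while the curve is
      still in \<open>C \<union> D\<close>, hence the detour through \<open>C\<close>.\<close>
    have "x t2 \<in> C" using t2 t1 t0 by (intro xC) auto
    moreover have "x t2 \<notin> K" using t2 by (intro after) auto
    ultimately have pos: "B (x t2) > 0" using K(1) by auto
    obtain M where M: "M \<in> null_sets lebesgue"
      "\<And>t. t \<notin> M \<Longrightarrow> t \<in> {a<..<b} \<Longrightarrow> \<exists>v \<in> F (x t). (x has_vector_derivative v) (at t)"
      by (rule AE_E3[OF ode]) auto
    \<comment> \<open>Growth at this rate over \<open>{t0..t2}\<close> reaches only half of
      \<open>B (x t2)\<close>, although it starts from a nonpositive value.\<close>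
    define c where "c = B (x t2) / 2 / (t2 - t0)"
    have c: "c > 0" using pos t2 by (simp add: c_def)
    have "B (x t2) - B (x t0) \<le> c * (t2 - t0)"
    proof (rule abs_cont_growth_le)
      show "t0 \<le> t2" using t2 by simp
      show "abs_cont_on_interval t0 t2 (\<lambda>s. B (x s))"
        using t0 t1 t2(2) xr
        by (intro abs_cont_on_interval_lipschitz_compose[OF _ r(2)] abs_cont_on_interval_subset[OF ac]) auto
      \<comment> \<open>The time \<open>t0\<close> is excluded since \<open>x t0\<close> is still in
        \<open>K\<close>, where the gradient condition says nothing.\<close>
      show "negligible (M \<union> {t0})" using M(1) by (simp add: negligible_iff_null_sets[symmetric])
      show "0 \<le> c" using c by simp
    next
      fix s assume s: "s \<in> {t0..t2} - (M \<union> {t0})"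
      then have sab: "s \<in> {a<..<b}" and s0: "t0 < s" "s \<le> t1" using t0 t1 t2 by auto
      then obtain v where v: "v \<in> F (x s)" "(x has_vector_derivative v) (at s)"
        using M(2) s by blast
      have "v \<in> contingent_cone C (x s)"
        using sab by (intro contingent_cone_if_curve[OF v(2), of b] xC) auto
      then have "\<zeta> \<bullet> v \<le> 0" if "\<zeta> \<in> clarke_gradient N B (x s)" for \<zeta>
        using that v(1) after[OF s0] xU xC[OF sab] s by (intro dec[of "x s"]) auto
      then obtain d where d: "d > 0"
        "\<And>u w. u \<le> s \<Longrightarrow> s \<le> w \<Longrightarrow> w - u < d \<Longrightarrow> B (x w) - B (x u) \<le> c * (w - u)"
        using clarke_curve_increment_le[OF r(2) open_ball xr N _ v(2) c] s by blast
      then show "\<exists>d>0. \<forall>u\<in>{t0..t2}. \<forall>w\<in>{t0..t2}. u \<le> s \<and> s \<le> w \<and> w - u < d \<longrightarrow>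
          B (x w) - B (x u) \<le> c * (w - u)"
        by blast
    qed
    moreover have "c * (t2 - t0) = B (x t2) / 2" using t2(1) by (simp add: c_def field_simps)
    moreover have "B (x t0) \<le> 0" using t0(3) K(1) by simp
    ultimately show False using pos by linarith
  qed
  show ?thesis
  proof (cases "a < b")
    case True
    \<comment> \<open>Continuity and the closedness of \<open>K\<close> add the endpoint
      \<open>b\<close>.\<close>
    have "x ` closure {a..<b} \<subseteq> K"
      using True cont before K(2) by (intro image_closure_subset) auto
    then show ?thesis using True t by (auto simp: image_subset_iff)
  next
    case False
    then have "t = a" using t by simp
    then show ?thesis using xa by simp
  qed
qed

theorem theorem4:
  fixes H :: "(real ^ 'n) hybrid_system"
    and B :: "real ^ 'n \<Rightarrow> real"
    and K :: "(real ^ 'n) set"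
    and \<Omega> :: "(real ^ 'n) set"
  assumes "outer_semicontinuous (flow_map H)"
    and "locally_bounded_map (flow_map H)"
    and "\<And>x. flow_map H x \<noteq> {}"
    and "\<And>x. convex (flow_map H x)"
    and "\<And>x. x \<in> jump_set H \<Longrightarrow> jump_map H x \<noteq> {}"
    and "locally_lipschitz B"
    and "barrier_candidate H B K"
    and "closed K"
    and "\<And>x \<eta>. x \<in> jump_set H \<inter> K \<Longrightarrow> \<eta> \<in> jump_map H x \<Longrightarrow> B \<eta> \<le> 0"
    and "\<And>x. x \<in> jump_set H \<inter> K \<Longrightarrow> jump_map H x \<subseteq> flow_set H \<union> jump_set H"
    and "negligible \<Omega>"
    and "\<exists>U. open U \<and> frontier K \<subseteq> U \<and>
           (\<forall>x \<in> (U - K) \<inter> flow_set H. \<forall>\<eta> \<in> flow_map H x \<inter> contingent_cone (flow_set H) x.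
              \<forall>\<zeta> \<in> clarke_gradient \<Omega> B x. \<zeta> \<bullet> \<eta> \<le> 0)"
  shows "forward_pre_invariant H K"
proof -
  have K: "K = {z \<in> flow_set H \<union> jump_set H. B z \<le> 0}"
    using assms(7) by (simp add: barrier_candidate_def)
  obtain U where U: "open U" "frontier K \<subseteq> U"
    and dec: "\<And>z \<eta> \<zeta>. z \<in> (U - K) \<inter> flow_set H \<Longrightarrow> \<eta> \<in> flow_map H z \<inter> contingent_cone (flow_set H) z \<Longrightarrow>
                \<zeta> \<in> clarke_gradient \<Omega> B z \<Longrightarrow> \<zeta> \<bullet> \<eta> \<le> 0"
    using assms(12) by meson
  have "x T J \<in> K" if sol: "hybrid_solution H E x" and x0: "x 0 0 \<in> K" and TJ: "(T, J) \<in> E" for E x T J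
  proof -
    have dom: "hybrid_time_domain E"
      and lac: "\<And>j. locally_abs_cont_on (flow_interval E j) (\<lambda>t. x t j)"
      and flow_C: "\<And>j t. t \<in> interior (flow_interval E j) \<Longrightarrow> x t j \<in> flow_set H"
      and flow_F: "\<And>j. interior (flow_interval E j) \<noteq> {} \<Longrightarrow> AE t in lebesgue. t \<in> flow_interval E j \<longrightarrow>
           (\<exists>v \<in> flow_map H (x t j).
              ((\<lambda>s. x s j) has_vector_derivative v) (at t within flow_interval E j))"
      and jump: "\<And>t j. (t, j) \<in> E \<Longrightarrow> (t, Suc j) \<in> E \<Longrightarrow>
           x t j \<in> jump_set H \<and> x t (Suc j) \<in> jump_map H (x t j)"
      using sol unfolding hybrid_solution_def by blast+
    \<comment> \<open>Truncating the domain at \<open>(T, J)\<close> gives finitely many flow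
      intervals, so induction on the jump count applies.\<close>
    obtain \<tau> where \<tau>: "\<tau> 0 = 0" "\<And>j. j \<le> J \<Longrightarrow> \<tau> j \<le> \<tau> (Suc j)"
        "E \<inter> ({0..T} \<times> {0..J}) = (\<Union>j\<le>J. {\<tau> j..\<tau> (Suc j)} \<times> {j})"
      using dom TJ unfolding hybrid_time_domain_def by blast
    have inE: "(t, j) \<in> E" if "j \<le> J" "t \<in> {\<tau> j..\<tau> (Suc j)}" for t j
      using \<tau>(3) that by blast
    have flow: "x t j \<in> K" if j: "j \<le> J" and start: "x (\<tau> j) j \<in> K" and t: "t \<in> {\<tau> j..\<tau> (Suc j)}" for t j
    proof (rule flow_stays_in_sublevel[where x = "\<lambda>t. x t j" and F = "flow_map H",
          OF K assms(8,6,11) U dec _ start _ _ t])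
      let ?I = "flow_interval E j"
      have sub: "{\<tau> j..\<tau> (Suc j)} \<subseteq> ?I" using inE[OF j] by (auto simp: flow_interval_def)
      then show "abs_cont_on_interval (\<tau> j) (\<tau> (Suc j)) (\<lambda>t. x t j)"
        using lac[of j] \<tau>(2)[OF j] unfolding locally_abs_cont_on_def by blast
      have int: "{\<tau> j<..<\<tau> (Suc j)} \<subseteq> interior ?I"
        using sub by (intro interior_maximal) auto
      then show "x s j \<in> flow_set H" if "s \<in> {\<tau> j<..<\<tau> (Suc j)}" for s
        using that flow_C by blast
      \<comment> \<open>An interval without interior, as between two simultaneous jumps, gives a
        vacuous claim. Otherwise \<open>s\<close> is interior to the flow interval and the
        derivative within it is a full one.\<close>
      show "AE s in lebesgue. s \<in> {\<tau> j<..<\<tau> (Suc j)} \<longrightarrow>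
          (\<exists>v \<in> flow_map H (x s j). ((\<lambda>s. x s j) has_vector_derivative v) (at s))"
      proof (cases "{\<tau> j<..<\<tau> (Suc j)} = {}")
        case False
        then have "interior ?I \<noteq> {}" using int by blast
        from flow_F[OF this] show ?thesis
        proof (rule eventually_mono, intro impI)
          fix s assume ode: "s \<in> ?I \<longrightarrow> (\<exists>v \<in> flow_map H (x s j).
              ((\<lambda>s. x s j) has_vector_derivative v) (at s within ?I))"
            and s: "s \<in> {\<tau> j<..<\<tau> (Suc j)}"
          have "s \<in> interior ?I" using int s by blast
          then show "\<exists>v \<in> flow_map H (x s j). ((\<lambda>s. x s j) has_vector_derivative v) (at s)"
            using ode interior_subset by (metis at_within_interior subsetD)
        qed
      qed simp
    qed
    have "\<forall>t\<in>{\<tau> j..\<tau> (Suc j)}. x t j \<in> K" if "j \<le> J" for j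
      using that
    proof (induction j)
      case 0
      then show ?case using flow[of 0] x0 \<tau>(1) by simp
    next
      case (Suc j)
      let ?t = "\<tau> (Suc j)"
      have "x ?t j \<in> K" using Suc \<tau>(2)[of j] by simp
      \<comment> \<open>The time \<open>?t\<close> ends one interval and begins the next, so both
        counts occur in the domain and the jump condition applies.\<close>
      moreover have "x ?t j \<in> jump_set H \<and> x ?t (Suc j) \<in> jump_map H (x ?t j)"
        using Suc.prems \<tau>(2)[of j] \<tau>(2)[of "Suc j"] by (intro jump inE) auto
      \<comment> \<open>Membership in \<open>K\<close> needs both jump hypotheses: the sign of
        \<open>B\<close> and landing in \<open>flow_set H \<union> jump_set H\<close>.\<close>
      ultimately have "x ?t (Suc j) \<in> K" using assms(9,10)[of "x ?t j"] K by blast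
      then show ?case using flow[OF Suc.prems] by blast
    qed
    moreover have "T \<in> {\<tau> J..\<tau> (Suc J)}"
    proof -
      have "0 \<le> T" using dom TJ unfolding hybrid_time_domain_def by auto
      then have "(T, J) \<in> E \<inter> ({0..T} \<times> {0..J})" using TJ by simp
      then show ?thesis unfolding \<tau>(3) by auto
    qed
    ultimately show ?thesis by blast
  qed
  then show ?thesis
    unfolding forward_pre_invariant_def maximal_hybrid_solution_def using K by blast
qed

end
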